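(* Let $T=[t_1,t_2]$ and let $(P_t)_{t\in T}$ with densities $p(\cdot,t)$ with respect to a $\sigma$-finite measure $\nu$ satisfy: $p$ is measurable, $t\mapsto p(x,t)$ is absolutely continuous for $\nu$-a.e. $x$, and the Fisher information $\mathcal{I}(t):=\int_{\mathcal{X}}(\partial_t p(x,t))^2/p(x,t)\,d\nu(x)$ is finite for all $t$ with $\int_T\mathcal{I}<\infty$. Suppose moreover that $\mathcal{I}$ is absolutely continuous on $T$. Let $\mathcal{A}$ be any class of functions $\alpha:T\to\mathbb{R}$ such that (i) $\alpha$ is absolutely continuous on $T$ with weak derivative $\alpha'$ such that $(\alpha')^2$ is absolutely continuous on $T$, and (ii) $\alpha(t_1)=\alpha(t_2)=0$. Then for every measurable $\hat t:\mathcal{X}\to\mathbb{R}$, $$\sup_{t\in T}\mathbb{E}_{P_t}\bigl[(\hat t(\boldsymbol{X})-t)^2\bigr]\;\ge\;\sup_{\alpha\in\mathcal{A}}\left(\frac{\int_T\alpha}{\int_T\sqrt{\mathcal{I}\alpha^2+(\alpha')^2}}\right)^2.$$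
   Context: $\mathbb{E}_{P_t}$ denotes expectation with $\boldsymbol{X}\sim P_t$. Convention: $1/0=0$. *)

theory Defs
  imports "HOL-Analysis.Analysis" "HOL-Probability.Probability"
begin

definition abs_cont_on :: "real \<Rightarrow> real \<Rightarrow> (real \<Rightarrow> real) \<Rightarrow> bool" where
  "abs_cont_on a b f \<longleftrightarrow>
     (\<forall>\<epsilon>>0. \<exists>\<delta>>0. \<forall>(n::nat) (u::nat \<Rightarrow> real) (v::nat \<Rightarrow> real).
        (\<forall>i<n. a \<le> u i \<and> u i \<le> v i \<and> v i \<le> b) \<and>
        (\<forall>i<n. \<forall>j<n. i \<noteq> j \<longrightarrow> v i \<le> u j \<or> v j \<le> u i) \<and>
        (\<Sum>i<n. v i - u i) < \<delta>
        \<longrightarrow> (\<Sum>i<n. \<bar>f (v i) - f (u i)\<bar>) < \<epsilon>)"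

text \<open>Partial derivative in t of p(x,t) (one-sided at the endpoints of [t1,t2]);
  set to 0 where it does not exist (a null set of t for a.e. x).\<close>
definition pdt :: "('a \<Rightarrow> real \<Rightarrow> real) \<Rightarrow> real \<Rightarrow> real \<Rightarrow> 'a \<Rightarrow> real \<Rightarrow> real" where
  "pdt p t1 t2 x t =
     (if (\<lambda>s. p x s) differentiable (at t within {t1..t2})
      then vector_derivative (\<lambda>s. p x s) (at t within {t1..t2}) else 0)"

text \<open>Fisher information I(t) = int (d_t p(x,t))^2 / p(x,t) dnu(x), with 1/0 = 0.\<close>
definition fisher_info :: "'a measure \<Rightarrow> ('a \<Rightarrow> real \<Rightarrow> real) \<Rightarrow> real \<Rightarrow> real \<Rightarrow> real \<Rightarrow> real" where
  "fisher_info \<nu> p t1 t2 t = (\<integral>x. (pdt p t1 t2 x t)\<^sup>2 / p x t \<partial>\<nu>)"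

definition admissible :: "real \<Rightarrow> real \<Rightarrow> (real \<Rightarrow> real) \<Rightarrow> (real \<Rightarrow> real) \<Rightarrow> bool" where
  "admissible t1 t2 \<alpha> \<alpha>' \<longleftrightarrow>
     abs_cont_on t1 t2 \<alpha> \<and>
     \<alpha>' integrable_on {t1..t2} \<and>
     (\<forall>t\<in>{t1..t2}. \<alpha> t = \<alpha> t1 + integral {t1..t} \<alpha>') \<and>
     abs_cont_on t1 t2 (\<lambda>t. (\<alpha>' t)\<^sup>2) \<and>
     \<alpha> t1 = 0 \<and> \<alpha> t2 = 0"

end

theory Submission
  imports Defs
begin

text \<open>
  Integrating the derivative of \<open>(th x - t) \<alpha>(t) p(x,t)\<close> in \<open>t\<close> over \<open>[t1,t2]\<close> gives \<open>0\<close>, because \<open>\<alpha>\<close> vanishes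
  at the endpoints; integrating over \<open>x\<close> as well and using Fubini,
  \<open>\<integral>\<alpha> = \<integral>\<integral> (th x - t) (\<alpha>' p + \<alpha> p') d\<nu> dt\<close>. For fixed \<open>t\<close>, Cauchy--Schwarz with weight \<open>p\<close> bounds the inner
  integral by the root of the risk times the root of \<open>\<integral> (\<alpha>' p + \<alpha> p')\<^sup>2 / p d\<nu> = \<alpha>'\<^sup>2 + \<I> \<alpha>\<^sup>2\<close>; the cross term
  drops out since \<open>\<integral> p' d\<nu> = 0\<close> for almost every \<open>t\<close>.

  This needs Lebesgue's theorem that an absolutely continuous function is almost everywhere differentiable
  and the integral of its derivative. It is written as a difference of increasing absolutely continuous functions
  by means of its total variation; the Stieltjes measure of such a function has no singular part, so
  Radon--Nikodym provides a density, which is the derivative by Lebesgue's differentiation theorem.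
\<close>

section \<open>Absolutely continuous functions\<close>

text \<open>Two obstacles shape the argument. The given density is known only on
  \<open>[t1,t2]\<close> and is absolutely continuous only for almost every \<open>x\<close>, and
  nothing makes \<open>pdt\<close> jointly measurable at the outset, so Fubini cannot be applied to
  it as it stands. Hence a version \<open>q\<close>, zero on the exceptional set of \<open>x\<close>
  and constant in \<open>t\<close> beyond the endpoints, and a derivative \<open>D\<close> that is a
  limit of difference quotients. The set where \<open>D\<close> is the derivative is measurable,
  which allows "almost every \<open>x\<close>, almost every \<open>t\<close>" to be exchanged. The
  estimator is arbitrary, so integrability must come from the estimates themselves. If the supremal
  risk is infinite the claim is trivial; if it is finite, Cauchy--Schwarz bounds the integrand
  before Fubini is used. For the derivative alone, the inequality of the means gives |p'| \<le> (p +
  p'^2/p)/2, hence the bound (1 + I(t))/2 for its integral over \<open>x\<close>. The convention 1/0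
  = 0 does no harm: a zero of a nonnegative density is a minimum in \<open>t\<close>, so at interior
  points the derivative, where it exists, vanishes too.\<close>

definition nonoverlapping :: "real \<Rightarrow> real \<Rightarrow> 'i set \<Rightarrow> ('i \<Rightarrow> real) \<Rightarrow> ('i \<Rightarrow> real) \<Rightarrow> bool" where
  "nonoverlapping a b I u v \<longleftrightarrow> finite I \<and> (\<forall>i\<in>I. a \<le> u i \<and> u i \<le> v i \<and> v i \<le> b) \<and>
     (\<forall>i\<in>I. \<forall>j\<in>I. i \<noteq> j \<longrightarrow> v i \<le> u j \<or> v j \<le> u i)"

definition increments :: "(real \<Rightarrow> real) \<Rightarrow> 'i set \<Rightarrow> ('i \<Rightarrow> real) \<Rightarrow> ('i \<Rightarrow> real) \<Rightarrow> real" where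
  "increments f I u v = (\<Sum>i\<in>I. \<bar>f (v i) - f (u i)\<bar>)"

lemma abs_cont_on_iff_nonoverlapping:
  "abs_cont_on a b f \<longleftrightarrow> (\<forall>\<epsilon>>0. \<exists>\<delta>>0. \<forall>n::nat. \<forall>u v.
     nonoverlapping a b {..<n} u v \<and> (\<Sum>i<n. v i - u i) < \<delta> \<longrightarrow> increments f {..<n} u v < \<epsilon>)"
  unfolding abs_cont_on_def nonoverlapping_def increments_def by (simp add: Ball_def conj_assoc)

lemma abs_cont_onE:
  assumes "abs_cont_on a b f" "0 < \<epsilon>"
  obtains \<delta> where "\<delta> > 0" "\<And>n u v. nonoverlapping a b {..<n::nat} u v \<Longrightarrow> (\<Sum>i<n. v i - u i) < \<delta>
      \<Longrightarrow> increments f {..<n} u v < \<epsilon>"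
  using assms(1)[unfolded abs_cont_on_iff_nonoverlapping, rule_format, OF assms(2)] that by auto

lemma nonoverlapping_reindex:
  assumes "bij_betw g J I" "nonoverlapping a b I u v"
  shows "nonoverlapping a b J (u \<circ> g) (v \<circ> g)"
proof -
  have "finite J" using assms bij_betw_finite by (auto simp: nonoverlapping_def)
  moreover have "g i \<in> I" if "i \<in> J" for i using assms that by (auto simp: bij_betw_def)
  moreover have "g i \<noteq> g j" if "i \<in> J" "j \<in> J" "i \<noteq> j" for i j
    using assms that by (auto simp: bij_betw_def inj_on_def)
  ultimately show ?thesis using assms(2) unfolding nonoverlapping_def by simp
qed

text \<open>The definition speaks of families indexed by initial segments of the naturals. The
  applications index by pairs (a family inside each interval of a family), by sets of reals
  (intervals of a covering) and by \<open>unit\<close> (a single interval).\<close>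

lemma abs_cont_on_indexedE:
  assumes "abs_cont_on a b f" "0 < \<epsilon>"
  obtains \<delta> where "\<delta> > 0" "\<And>(I::'i set) u v. nonoverlapping a b I u v \<Longrightarrow> (\<Sum>i\<in>I. v i - u i) < \<delta> \<Longrightarrow> increments f I u v < \<epsilon>"
proof -
  obtain \<delta> where "\<delta> > 0" and \<delta>: "\<And>n u v. nonoverlapping a b {..<n::nat} u v \<Longrightarrow> (\<Sum>i<n. v i - u i) < \<delta>
      \<Longrightarrow> increments f {..<n} u v < \<epsilon>"
    using abs_cont_onE[OF assms] by blast
  have "increments f I u v < \<epsilon>" if "nonoverlapping a b I u v" "(\<Sum>i\<in>I. v i - u i) < \<delta>" for I :: "'i set" and u v
  proof -
    have "finite I" using that by (simp add: nonoverlapping_def)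
    then obtain g where g: "bij_betw g {..<card I} I"
      using ex_bij_betw_nat_finite by (metis atLeast0LessThan)
    have "increments f {..<card I} (u \<circ> g) (v \<circ> g) < \<epsilon>"
      using \<delta>[OF nonoverlapping_reindex[OF g that(1)]] that(2) sum.reindex_bij_betw[OF g, of "\<lambda>i. v i - u i"]
      by (simp add: o_def)
    then show ?thesis
      using sum.reindex_bij_betw[OF g, of "\<lambda>i. \<bar>f (v i) - f (u i)\<bar>"] by (simp add: increments_def o_def)
  qed
  with \<open>\<delta> > 0\<close> show thesis by (rule that)
qed

text \<open>Neighbouring intervals may share endpoints, so disjointness holds for the open
  intervals, which have the same length. The set \<open>S\<close> will be either the whole interval
  or a small open neighbourhood of a null set.\<close>

lemma nonoverlapping_length_le:
  assumes "nonoverlapping a b I u v" "S \<in> fmeasurable lborel" "\<And>i. i \<in> I \<Longrightarrow> {u i<..<v i} \<subseteq> S"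
  shows "(\<Sum>i\<in>I. v i - u i) \<le> measure lborel S"
proof -
  have "(\<Sum>i\<in>I. v i - u i) = (\<Sum>i\<in>I. measure lborel {u i<..<v i})"
    using assms(1) by (intro sum.cong) (auto simp: nonoverlapping_def)
  also have "\<dots> = measure lborel (\<Union>i\<in>I. {u i<..<v i})"
  proof (rule measure_finite_Union[symmetric])
    show "disjoint_family_on (\<lambda>i. {u i<..<v i}) I"
      unfolding disjoint_family_on_def
    proof (intro ballI impI)
      fix i j assume "i \<in> I" "j \<in> I" "i \<noteq> j"
      then have "v i \<le> u j \<or> v j \<le> u i" using assms(1) by (simp add: nonoverlapping_def)
      then show "{u i<..<v i} \<inter> {u j<..<v j} = {}" by auto
    qed
  qed (use assms(1) in \<open>auto simp: nonoverlapping_def emeasure_lborel_box_eq\<close>)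
  also have "\<dots> \<le> measure lborel S"
    using assms by (intro measure_mono_fmeasurable) (auto simp: nonoverlapping_def intro!: sets.finite_UN)
  finally show ?thesis .
qed

lemma nonoverlapping_length_le_Icc:
  assumes "nonoverlapping a b I u v" "a \<le> b"
  shows "(\<Sum>i\<in>I. v i - u i) \<le> b - a"
proof -
  have "(\<Sum>i\<in>I. v i - u i) \<le> measure lborel {a..b}"
  proof (rule nonoverlapping_length_le[OF assms(1)])
    show "{a..b} \<in> fmeasurable lborel" using assms(2) by (intro fmeasurableI) auto
    show "{u i<..<v i} \<subseteq> {a..b}" if "i \<in> I" for i
      using assms(1) that unfolding nonoverlapping_def by force
  qed
  then show ?thesis using assms(2) by simp
qed

text \<open>Cutting with \<open>min\<close> and \<open>max\<close> keeps the index set; intervals on the wrong side of \<open>c\<close> degenerate to \<open>[c,c]\<close>.\<close>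
lemma nonoverlapping_split:
  assumes "nonoverlapping a b I u v" "a \<le> c" "c \<le> b"
  shows "nonoverlapping a c I (\<lambda>i. min (u i) c) (\<lambda>i. min (v i) c)"
    and "nonoverlapping c b I (\<lambda>i. max (u i) c) (\<lambda>i. max (v i) c)"
    and "increments f I u v \<le> increments f I (\<lambda>i. min (u i) c) (\<lambda>i. min (v i) c) +
           increments f I (\<lambda>i. max (u i) c) (\<lambda>i. max (v i) c)"
proof -
  have fin: "finite I" using assms(1) by (auto simp: nonoverlapping_def)
  have uv: "a \<le> u i" "u i \<le> v i" "v i \<le> b" if "i \<in> I" for i
    using assms(1) that by (auto simp: nonoverlapping_def)
  have sep: "v i \<le> u j \<or> v j \<le> u i" if "i \<in> I" "j \<in> I" "i \<noteq> j" for i j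
    using assms(1) that by (auto simp: nonoverlapping_def)
  show "nonoverlapping a c I (\<lambda>i. min (u i) c) (\<lambda>i. min (v i) c)"
    unfolding nonoverlapping_def
  proof (intro conjI ballI impI)
    fix i j assume "i \<in> I" "j \<in> I" "i \<noteq> j"
    then show "min (v i) c \<le> min (u j) c \<or> min (v j) c \<le> min (u i) c" using sep[of i j] by linarith
  qed (use fin uv assms(2,3) in \<open>auto simp: min.coboundedI1\<close>)
  show "nonoverlapping c b I (\<lambda>i. max (u i) c) (\<lambda>i. max (v i) c)"
    unfolding nonoverlapping_def
  proof (intro conjI ballI impI)
    fix i j assume "i \<in> I" "j \<in> I" "i \<noteq> j"
    then show "max (v i) c \<le> max (u j) c \<or> max (v j) c \<le> max (u i) c" using sep[of i j] by linarith
  qed (use fin uv assms(2,3) in \<open>auto simp: max.coboundedI1\<close>)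
  show "increments f I u v \<le> increments f I (\<lambda>i. min (u i) c) (\<lambda>i. min (v i) c) +
           increments f I (\<lambda>i. max (u i) c) (\<lambda>i. max (v i) c)"
    unfolding increments_def sum.distrib[symmetric]
    using assms by (intro sum_mono) (auto simp: nonoverlapping_def min_def max_def)
qed

lemma nonoverlapping_mono:
  assumes "nonoverlapping a b I u v" "a' \<le> a" "b \<le> b'"
  shows "nonoverlapping a' b' I u v"
  using assms unfolding nonoverlapping_def by force

lemma abs_cont_on_subset:
  assumes "abs_cont_on a b f" "a \<le> a'" "b' \<le> b"
  shows "abs_cont_on a' b' f"
  unfolding abs_cont_on_iff_nonoverlapping
proof (intro allI impI)
  fix \<epsilon> :: real assume "0 < \<epsilon>"
  then obtain \<delta> where "\<delta> > 0" "\<And>n u v. nonoverlapping a b {..<n::nat} u v \<Longrightarrow> (\<Sum>i<n. v i - u i) < \<delta>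
      \<Longrightarrow> increments f {..<n} u v < \<epsilon>"
    using abs_cont_onE[OF assms(1)] by blast
  then show "\<exists>\<delta>>0. \<forall>n::nat. \<forall>u v. nonoverlapping a' b' {..<n} u v \<and> (\<Sum>i<n. v i - u i) < \<delta> \<longrightarrow>
      increments f {..<n} u v < \<epsilon>"
    using nonoverlapping_mono[OF _ assms(2,3)] by blast
qed

section \<open>Bounded variation and the variation function\<close>

lemma abs_cont_on_bounded_increments:
  assumes "abs_cont_on a b f"
  shows "\<exists>B. \<forall>n::nat. \<forall>u v. nonoverlapping a b {..<n} u v \<longrightarrow> increments f {..<n} u v \<le> B"
proof -
  obtain \<delta> where "\<delta> > 0" and \<delta>: "\<And>n u v. nonoverlapping a b {..<n::nat} u v \<Longrightarrow> (\<Sum>i<n. v i - u i) < \<delta>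
      \<Longrightarrow> increments f {..<n} u v < 1"
    using abs_cont_onE[OF assms zero_less_one] by blast
  \<comment> \<open>The interval is consumed in pieces of length \<open>\<delta>/2\<close>, where
    \<open>\<delta>\<close> belongs to \<open>\<epsilon> = 1\<close>. Cutting a family at
    \<open>c\<close> leaves one family covered by induction and one inside a piece shorter than
    \<open>\<delta>\<close>, which adds less than 1. Halving makes the length of the piece strictly
    smaller than \<open>\<delta>\<close>.\<close>
  have step: "increments f {..<n} u v \<le> real k"
    if "nonoverlapping a (min b (a + real k * (\<delta>/2))) {..<n::nat} u v" for k n u v
    using that
  proof (induction k arbitrary: n u v)
    case 0
    then have "\<forall>i<n. u i = v i" by (force simp: nonoverlapping_def)
    then show ?case by (simp add: increments_def)
  next
    case (Suc k)
    define c where "c = min b (a + real k * (\<delta>/2))"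
    define d where "d = min b (a + real (Suc k) * (\<delta>/2))"
    show ?case
    proof (cases "a \<le> b")
      case True
      have "0 \<le> real k * (\<delta>/2)" using \<open>\<delta> > 0\<close> by simp
      then have "a \<le> c" using True unfolding c_def by linarith
      have dc: "d = min b ((a + real k * (\<delta>/2)) + \<delta>/2)" unfolding d_def by (simp add: field_simps)
      have cd: "a \<le> c" "c \<le> d" "d \<le> b" "d - c < \<delta>"
        using True \<open>\<delta> > 0\<close> \<open>a \<le> c\<close> unfolding dc c_def by linarith+
      have no: "nonoverlapping a d {..<n} u v" using Suc.prems unfolding d_def by simp
      note sp = nonoverlapping_split[OF no cd(1,2)]
      have "increments f {..<n} (\<lambda>i. min (u i) c) (\<lambda>i. min (v i) c) \<le> real k"
        using sp(1) Suc.IH unfolding c_def by blast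
      moreover have "increments f {..<n} (\<lambda>i. max (u i) c) (\<lambda>i. max (v i) c) < 1"
      proof (rule \<delta>)
        show "nonoverlapping a b {..<n} (\<lambda>i. max (u i) c) (\<lambda>i. max (v i) c)"
          using sp(2) cd nonoverlapping_mono by blast
        show "(\<Sum>i<n. max (v i) c - max (u i) c) < \<delta>"
          using nonoverlapping_length_le_Icc[OF sp(2) cd(2)] cd(4) by linarith
      qed
      ultimately show ?thesis using sp(3)[of f] by simp
    next
      case False
      then have "n = 0" using Suc.prems by (force simp: nonoverlapping_def)
      then show ?thesis by (simp add: increments_def)
    qed
  qed
  obtain k where "(b - a) / (\<delta>/2) \<le> real k" using real_arch_simple by blast
  then have "b \<le> a + real k * (\<delta>/2)" using \<open>\<delta> > 0\<close> by (simp add: field_simps)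
  then have "min b (a + real k * (\<delta>/2)) = b" by simp
  then show ?thesis using step[of k] by auto
qed

lemma nonoverlapping_Sigma:
  assumes "nonoverlapping a b I u v" "\<And>i. i \<in> I \<Longrightarrow> nonoverlapping (u i) (v i) (J i) (x i) (y i)"
  shows "nonoverlapping a b (Sigma I J) (\<lambda>(i, j). x i j) (\<lambda>(i, j). y i j)"
  unfolding nonoverlapping_def
proof (intro conjI ballI impI)
  show "finite (Sigma I J)" using assms by (auto simp: nonoverlapping_def)
next
  fix p assume "p \<in> Sigma I J"
  then obtain i j where p: "p = (i, j)" "i \<in> I" "j \<in> J i" by auto
  then have "u i \<le> x i j" "x i j \<le> y i j" "y i j \<le> v i" using assms(2)[of i] by (auto simp: nonoverlapping_def)
  moreover have "a \<le> u i" "v i \<le> b" using p assms(1) by (auto simp: nonoverlapping_def)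
  ultimately show "a \<le> (case p of (i, j) \<Rightarrow> x i j)" "(case p of (i, j) \<Rightarrow> x i j) \<le> (case p of (i, j) \<Rightarrow> y i j)"
    "(case p of (i, j) \<Rightarrow> y i j) \<le> b" by (auto simp: p)
next
  fix p q assume "p \<in> Sigma I J" "q \<in> Sigma I J" and ne: "p \<noteq> q"
  then obtain i j k l where p: "p = (i, j)" "i \<in> I" "j \<in> J i" and q: "q = (k, l)" "k \<in> I" "l \<in> J k" by blast
  have b: "u i \<le> x i j" "y i j \<le> v i" "u k \<le> x k l" "y k l \<le> v k"
    using p q assms(2)[of i] assms(2)[of k] by (auto simp: nonoverlapping_def)
  show "(case p of (i, j) \<Rightarrow> y i j) \<le> (case q of (i, j) \<Rightarrow> x i j) \<or>
    (case q of (i, j) \<Rightarrow> y i j) \<le> (case p of (i, j) \<Rightarrow> x i j)"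
  proof (cases "i = k")
    case True
    then show ?thesis using assms(2)[of i] p q ne by (auto simp: nonoverlapping_def)
  next
    case False
    then have "v i \<le> u k \<or> v k \<le> u i" using assms(1) p q by (auto simp: nonoverlapping_def)
    then show ?thesis using b p q by auto
  qed
qed

text \<open>Arbitrary finite families replace partitions. Gaps can only lower the sum, so the
  supremum is the usual variation, while families can be cut and extended without keeping
  consecutive endpoints matched.\<close>

definition total_variation :: "(real \<Rightarrow> real) \<Rightarrow> real \<Rightarrow> real \<Rightarrow> real" where
  "total_variation f a t =
     (SUP (n, u, v) \<in> {(n, u, v). nonoverlapping a t {..<n::nat} u v}. increments f {..<n} u v)"

context
  fixes a b :: real and f :: "real \<Rightarrow> real"
  assumes ac: "abs_cont_on a b f"
begin

lemma increments_le_total_variation: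
  assumes "nonoverlapping a t {..<n::nat} u v" "t \<le> b"
  shows "increments f {..<n} u v \<le> total_variation f a t"
proof -
  obtain B where B: "\<And>n u v. nonoverlapping a b {..<n::nat} u v \<Longrightarrow> increments f {..<n} u v \<le> B"
    using abs_cont_on_bounded_increments[OF ac] by blast
  have bdd: "bdd_above ((\<lambda>(n, u, v). increments f {..<n} u v) ` {(n, u, v). nonoverlapping a t {..<n::nat} u v})"
    by (rule bdd_aboveI[of _ B]) (auto intro!: B intro: nonoverlapping_mono[OF _ order_refl assms(2)])
  show ?thesis
    unfolding total_variation_def
    by (rule cSUP_upper2[OF bdd, of "(n, u, v)"]) (use assms in auto)
qed

lemma total_variation_approx:
  assumes "0 < \<eta>"
  obtains n u v where "nonoverlapping a t {..<n::nat} u v" "total_variation f a t < increments f {..<n} u v + \<eta>"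
proof -
  let ?S = "{(n, u, v). nonoverlapping a t {..<n::nat} u v}"
  let ?g = "\<lambda>(n::nat, u, v). increments f {..<n} u v"
  have ne: "(0, \<lambda>_. 0, \<lambda>_. 0) \<in> ?S" by (simp add: nonoverlapping_def)
  have "\<exists>c\<in>?S. total_variation f a t - \<eta> < ?g c"
  proof (rule ccontr)
    assume "\<not> ?thesis"
    then have "total_variation f a t \<le> total_variation f a t - \<eta>"
      using ne unfolding total_variation_def by (intro cSUP_least) fastforce+
    then show False using assms by simp
  qed
  then show thesis using that by fastforce
qed

text \<open>A nearly optimal family below \<open>s\<close> is extended by the single interval
  \<open>[s,t]\<close>. The inequality makes both the variation and its sum with \<open>f\<close>
  increasing, so that \<open>f\<close> is a difference of two increasing functions.\<close>

lemma total_variation_increase: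
  assumes "a \<le> s" "s \<le> t" "t \<le> b"
  shows "total_variation f a s + \<bar>f t - f s\<bar> \<le> total_variation f a t"
proof (rule field_le_epsilon)
  fix \<eta> :: real assume "0 < \<eta>"
  then obtain n u v where no: "nonoverlapping a s {..<n::nat} u v"
    and tv: "total_variation f a s < increments f {..<n} u v + \<eta>"
    by (rule total_variation_approx)
  have "nonoverlapping a t {..<Suc n} (u(n := s)) (v(n := t))"
    using no assms unfolding nonoverlapping_def by (auto simp: less_Suc_eq) force+
  then have "increments f {..<Suc n} (u(n := s)) (v(n := t)) \<le> total_variation f a t"
    using assms by (intro increments_le_total_variation)
  moreover have "increments f {..<Suc n} (u(n := s)) (v(n := t)) = increments f {..<n} u v + \<bar>f t - f s\<bar>"
    unfolding increments_def by (auto intro!: sum.cong)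
  ultimately show "total_variation f a s + \<bar>f t - f s\<bar> \<le> total_variation f a t + \<eta>"
    using tv by linarith
qed

text \<open>Cut a nearly optimal family for \<open>t\<close> at \<open>s\<close>: the lower part
  contributes at most the variation up to \<open>s\<close>, so the upper part must account for the
  increase, up to \<open>\<eta>\<close>.\<close>

lemma total_variation_step:
  assumes "a \<le> s" "s \<le> t" "t \<le> b" "0 < \<eta>"
  obtains n u v where "nonoverlapping s t {..<n::nat} u v"
    "total_variation f a t - total_variation f a s < increments f {..<n} u v + \<eta>"
proof -
  from assms(4) obtain n u v where no: "nonoverlapping a t {..<n::nat} u v"
    and tv: "total_variation f a t < increments f {..<n} u v + \<eta>"
    by (rule total_variation_approx)
  note sp = nonoverlapping_split[OF no assms(1,2)]
  have "increments f {..<n} (\<lambda>i. min (u i) s) (\<lambda>i. min (v i) s) \<le> total_variation f a s"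
    using sp(1) assms by (intro increments_le_total_variation) auto
  then have "total_variation f a t - total_variation f a s
      < increments f {..<n} (\<lambda>i. max (u i) s) (\<lambda>i. max (v i) s) + \<eta>"
    using sp(3)[of f] tv by linarith
  with sp(2) show thesis by (rule that)
qed

text \<open>Each increment of the variation is, up to \<open>\<eta>\<close>, a sum of increments of
  \<open>f\<close> over a family inside the same interval. These families together form one family
  of no greater total length, so the \<open>\<delta>\<close> that \<open>f\<close> has for
  \<open>\<epsilon>/2\<close> works for the variation.\<close>

lemma abs_cont_on_total_variation: "abs_cont_on a b (total_variation f a)"
  unfolding abs_cont_on_iff_nonoverlapping
proof (intro allI impI)
  fix \<epsilon> :: real assume \<epsilon>: "0 < \<epsilon>"
  let ?V = "total_variation f a"
  obtain \<delta> where "\<delta> > 0" and \<delta>: "\<And>I::(nat \<times> nat) set. \<And>u v. nonoverlapping a b I u v \<Longrightarrow> (\<Sum>i\<in>I. v i - u i) < \<delta>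
      \<Longrightarrow> increments f I u v < \<epsilon>/2"
    using abs_cont_on_indexedE[OF ac half_gt_zero[OF \<epsilon>], where 'i = "nat \<times> nat"] by blast
  have "increments ?V {..<n} u v < \<epsilon>"
    if no: "nonoverlapping a b {..<n::nat} u v" and len: "(\<Sum>i<n. v i - u i) < \<delta>" for n u v
  proof -
    \<comment> \<open>The error is incurred \<open>n\<close> times; \<open>Suc n\<close> in the
      denominator keeps the sum strictly below \<open>\<epsilon>/2\<close> and makes sense for
      \<open>n = 0\<close>.\<close>
    define \<eta> where "\<eta> = \<epsilon> / (2 * real (Suc n))"
    have "\<eta> > 0" using \<epsilon> by (simp add: \<eta>_def)
    have uv: "a \<le> u i" "u i \<le> v i" "v i \<le> b" if "i < n" for i using no that by (auto simp: nonoverlapping_def)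
    have "\<exists>m x y. nonoverlapping (u i) (v i) {..<m::nat} x y \<and> ?V (v i) - ?V (u i) < increments f {..<m} x y + \<eta>"
      if "i < n" for i
      using total_variation_step[OF uv[OF that] \<open>\<eta> > 0\<close>] by metis
    then obtain m x y where xy: "\<And>i. i < n \<Longrightarrow> nonoverlapping (u i) (v i) {..<m i::nat} (x i) (y i)"
      and V: "\<And>i. i < n \<Longrightarrow> ?V (v i) - ?V (u i) < increments f {..<m i} (x i) (y i) + \<eta>"
      by metis
    let ?I = "Sigma {..<n} (\<lambda>i. {..<m i})"
    have no': "nonoverlapping a b ?I (\<lambda>(i, j). x i j) (\<lambda>(i, j). y i j)"
      using no xy by (intro nonoverlapping_Sigma) auto
    have "(\<Sum>p\<in>?I. (case p of (i, j) \<Rightarrow> y i j) - (case p of (i, j) \<Rightarrow> x i j)) = (\<Sum>i<n. \<Sum>j<m i. y i j - x i j)"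
      by (subst sum.Sigma) (auto intro!: sum.cong)
    also have "\<dots> \<le> (\<Sum>i<n. v i - u i)"
      using uv xy by (intro sum_mono nonoverlapping_length_le_Icc) auto
    finally have "increments f ?I (\<lambda>(i, j). x i j) (\<lambda>(i, j). y i j) < \<epsilon>/2"
      using len by (intro \<delta>[OF no']) auto
    moreover have "increments f ?I (\<lambda>(i, j). x i j) (\<lambda>(i, j). y i j) = (\<Sum>i<n. increments f {..<m i} (x i) (y i))"
      unfolding increments_def by (subst sum.Sigma) (auto intro!: sum.cong)
    moreover have "increments ?V {..<n} u v \<le> (\<Sum>i<n. increments f {..<m i} (x i) (y i) + \<eta>)"
      unfolding increments_def[of ?V]
    proof (rule sum_mono)
      fix i assume "i \<in> {..<n}"
      then show "\<bar>?V (v i) - ?V (u i)\<bar> \<le> increments f {..<m i} (x i) (y i) + \<eta>"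
        using V[of i] total_variation_increase[OF uv, of i] by simp
    qed
    moreover have "(\<Sum>i<n. \<eta>) < \<epsilon>/2"
      using \<epsilon> by (simp add: \<eta>_def field_simps)
    ultimately show ?thesis by (simp add: sum.distrib)
  qed
  then show "\<exists>\<delta>>0. \<forall>n::nat. \<forall>u v. nonoverlapping a b {..<n} u v \<and> (\<Sum>i<n. v i - u i) < \<delta> \<longrightarrow> increments ?V {..<n} u v < \<epsilon>"
    using \<open>\<delta> > 0\<close> by blast
qed

end

section \<open>Continuity and closure properties\<close>

lemma abs_cont_on_continuous_on:
  assumes "abs_cont_on a b f"
  shows "continuous_on {a..b} f"
  unfolding continuous_on_iff
proof (intro ballI allI impI)
  fix x e :: real assume x: "x \<in> {a..b}" and "0 < e"
  then obtain \<delta> where "\<delta> > 0" and \<delta>: "\<And>I::unit set. \<And>u v. nonoverlapping a b I u v \<Longrightarrow> (\<Sum>i\<in>I. v i - u i) < \<delta>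
      \<Longrightarrow> increments f I u v < e"
    using abs_cont_on_indexedE[OF assms, of e, where 'i = unit] by blast
  have "dist (f y) (f x) < e" if "y \<in> {a..b}" "dist y x < \<delta>" for y
    using \<delta>[of "{()}" "\<lambda>_. min x y" "\<lambda>_. max x y"] that x
    by (cases "x \<le> y") (auto simp: nonoverlapping_def increments_def dist_real_def min_def max_def abs_minus_commute)
  then show "\<exists>d>0. \<forall>x'\<in>{a..b}. dist x' x < d \<longrightarrow> dist (f x') (f x) < e"
    using \<open>\<delta> > 0\<close> by blast
qed

text \<open>A common criterion for sums, differences, products, constants and functions that agree
  on the interval: in each case the increments are controlled linearly by those of functions already
  known to be absolutely continuous.\<close>

lemma abs_cont_on_dominated:
  assumes "abs_cont_on a b f" "abs_cont_on a b g"
    and le: "\<And>s t. a \<le> s \<Longrightarrow> s \<le> t \<Longrightarrow> t \<le> b \<Longrightarrow> \<bar>h t - h s\<bar> \<le> A * \<bar>f t - f s\<bar> + B * \<bar>g t - g s\<bar>"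
    and "0 < A" "0 < B"
  shows "abs_cont_on a b h"
  unfolding abs_cont_on_iff_nonoverlapping
proof (intro allI impI)
  fix \<epsilon> :: real assume "0 < \<epsilon>"
  then have "0 < \<epsilon>/(2*A)" "0 < \<epsilon>/(2*B)" using assms by auto
  obtain \<delta>1 where "\<delta>1 > 0" and \<delta>1: "\<And>n u v. nonoverlapping a b {..<n::nat} u v \<Longrightarrow> (\<Sum>i<n. v i - u i) < \<delta>1
      \<Longrightarrow> increments f {..<n} u v < \<epsilon>/(2*A)"
    using abs_cont_onE[OF assms(1) \<open>0 < \<epsilon>/(2*A)\<close>] by blast
  obtain \<delta>2 where "\<delta>2 > 0" and \<delta>2: "\<And>n u v. nonoverlapping a b {..<n::nat} u v \<Longrightarrow> (\<Sum>i<n. v i - u i) < \<delta>2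
      \<Longrightarrow> increments g {..<n} u v < \<epsilon>/(2*B)"
    using abs_cont_onE[OF assms(2) \<open>0 < \<epsilon>/(2*B)\<close>] by blast
  have "increments h {..<n} u v < \<epsilon>"
    if no: "nonoverlapping a b {..<n::nat} u v" and "(\<Sum>i<n. v i - u i) < min \<delta>1 \<delta>2" for n u v
  proof -
    have "increments h {..<n} u v \<le> A * increments f {..<n} u v + B * increments g {..<n} u v"
      unfolding increments_def sum_distrib_left sum.distrib[symmetric]
      using no by (intro sum_mono le) (auto simp: nonoverlapping_def)
    moreover have "A * increments f {..<n} u v < \<epsilon>/2" "B * increments g {..<n} u v < \<epsilon>/2"
      using \<delta>1[OF no] \<delta>2[OF no] that assms(4,5) by (auto simp: field_simps)
    ultimately show ?thesis by linarith
  qed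
  then show "\<exists>\<delta>>0. \<forall>n::nat. \<forall>u v. nonoverlapping a b {..<n} u v \<and> (\<Sum>i<n. v i - u i) < \<delta> \<longrightarrow> increments h {..<n} u v < \<epsilon>"
    using \<open>\<delta>1 > 0\<close> \<open>\<delta>2 > 0\<close> by (intro exI[of _ "min \<delta>1 \<delta>2"]) auto
qed

lemma abs_cont_on_ident: "abs_cont_on a b (\<lambda>t. t)"
  unfolding abs_cont_on_iff_nonoverlapping
proof (intro allI impI)
  fix \<epsilon> :: real assume "0 < \<epsilon>"
  moreover have "increments (\<lambda>t. t) {..<n} u v = (\<Sum>i<n. v i - u i)" if "nonoverlapping a b {..<n::nat} u v" for n u v
    using that by (auto simp: increments_def nonoverlapping_def intro!: sum.cong)
  ultimately show "\<exists>\<delta>>0. \<forall>n::nat. \<forall>u v. nonoverlapping a b {..<n} u v \<and> (\<Sum>i<n. v i - u i) < \<delta> \<longrightarrow>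
      increments (\<lambda>t. t) {..<n} u v < \<epsilon>"
    by auto
qed

lemma abs_cont_on_mult:
  assumes "abs_cont_on a b f" "abs_cont_on a b g"
  shows "abs_cont_on a b (\<lambda>t. f t * g t)"
proof -
  have "\<exists>B>0. \<forall>t\<in>{a..b}. \<bar>h t\<bar> \<le> B" if "abs_cont_on a b h" for h
  proof -
    have "bounded (h ` {a..b})"
      using abs_cont_on_continuous_on[OF that] compact_Icc compact_continuous_image compact_imp_bounded by blast
    then show ?thesis by (simp add: bounded_pos)
  qed
  then obtain F G where F: "F > 0" "\<And>t. t \<in> {a..b} \<Longrightarrow> \<bar>f t\<bar> \<le> F" and G: "G > 0" "\<And>t. t \<in> {a..b} \<Longrightarrow> \<bar>g t\<bar> \<le> G"
    using assms by metis
  show ?thesis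
  proof (rule abs_cont_on_dominated[OF assms _ G(1) F(1)])
    fix s t assume st: "a \<le> s" "s \<le> t" "t \<le> b"
    have "f t * g t - f s * g s = g t * (f t - f s) + f s * (g t - g s)" by (simp add: algebra_simps)
    then have "\<bar>f t * g t - f s * g s\<bar> \<le> \<bar>g t\<bar> * \<bar>f t - f s\<bar> + \<bar>f s\<bar> * \<bar>g t - g s\<bar>"
      using abs_triangle_ineq[of "g t * (f t - f s)" "f s * (g t - g s)"] by (simp only: abs_mult)
    also have "\<dots> \<le> G * \<bar>f t - f s\<bar> + F * \<bar>g t - g s\<bar>"
      using F(2)[of s] G(2)[of t] st by (intro add_mono mult_right_mono) auto
    finally show "\<bar>f t * g t - f s * g s\<bar> \<le> G * \<bar>f t - f s\<bar> + F * \<bar>g t - g s\<bar>" .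
  qed
qed

section \<open>Stieltjes measures of increasing absolutely continuous functions\<close>

lemma interval_measure_null_of_abs_cont:
  fixes F :: "real \<Rightarrow> real"
  assumes mono: "\<And>x y. x \<le> y \<Longrightarrow> F x \<le> F y" and cont: "continuous_on UNIV F"
    and ac: "abs_cont_on a b F" and "a < b" and N: "N \<in> null_sets lborel" "N \<subseteq> {a..b}"
  shows "emeasure (interval_measure F) N = 0"
proof -
  let ?\<mu> = "interval_measure F"
  have Icc: "emeasure ?\<mu> {c..d} = ennreal (F d - F c)" if "c \<le> d" for c d
    using emeasure_interval_measure_Icc[OF that mono cont] .
  have le: "emeasure ?\<mu> N \<le> ennreal \<epsilon>" if "\<epsilon> > 0" for \<epsilon>
  proof -
    obtain \<delta> where "\<delta> > 0" and \<delta>: "\<And>(I::real set set) u v. nonoverlapping a b I u v \<Longrightarrow>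
        (\<Sum>i\<in>I. v i - u i) < \<delta> \<Longrightarrow> increments F I u v < \<epsilon>"
      using abs_cont_on_indexedE[OF ac \<open>\<epsilon> > 0\<close>, where 'i = "real set"] by blast
    have Nl: "N \<in> null_sets lebesgue" using N(1) by (rule null_sets_completionI)
    \<comment> \<open>As \<open>N\<close> is null, an open set around it can be chosen with length
      below the \<open>\<delta>\<close> of absolute continuity.\<close>
    obtain U where U: "open U" "N \<subseteq> U" "U - N \<in> lmeasurable" "emeasure lebesgue (U - N) < ennreal \<delta>"
      using sets_lebesgue_outer_open[OF null_setsD2[OF Nl] \<open>\<delta> > 0\<close>] by blast
    have "emeasure lborel U = emeasure lebesgue (U - N)"
      using U(1) Nl emeasure_Diff_null_set[OF Nl, of U] by simp
    then have Ud: "emeasure lborel U < ennreal \<delta>" using U(4) by simp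
    then have Ufm: "U \<in> fmeasurable lborel"
      using U(1) by (intro fmeasurableI) (auto intro: less_le_trans)
    have mU: "measure lborel U < \<delta>"
      using Ud \<open>\<delta> > 0\<close> emeasure_eq_measure2[OF Ufm] by (simp add: ennreal_less_iff)
    \<comment> \<open>The gauge takes the value \<open>U\<close> at every point of \<open>N\<close>;
      each covering interval is tagged by such a point and therefore lies in \<open>U\<close>.
      Covering \<open>N\<close> within \<open>[a,b]\<close>, instead of decomposing
      \<open>U\<close>, keeps all intervals where \<open>F\<close> is known to be absolutely
      continuous.\<close>
    obtain \<D> where D: "countable \<D>" "\<Union>\<D> \<subseteq> cbox a b"
        "\<And>K. K \<in> \<D> \<Longrightarrow> interior K \<noteq> {} \<and> (\<exists>c d. K = cbox c d)"
        "pairwise (\<lambda>A B. interior A \<inter> interior B = {}) \<D>"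
        "\<And>K. K \<in> \<D> \<Longrightarrow> \<exists>x \<in> N \<inter> K. K \<subseteq> (if x \<in> U then U else UNIV)" "N \<subseteq> \<Union>\<D>"
    proof (rule covering_lemma[of N a b "\<lambda>x. if x \<in> U then U else UNIV"])
      show "gauge (\<lambda>x. if x \<in> U then U else UNIV)" using U(1) by (auto simp: gauge_def)
    qed (use N(2) \<open>a < b\<close> in auto)
    \<comment> \<open>Each interval serves as its own index, with its endpoints recovered by
      \<open>Inf\<close> and \<open>Sup\<close>.\<close>
    have K: "K = {Inf K..Sup K} \<and> Inf K < Sup K \<and> a \<le> Inf K \<and> Sup K \<le> b \<and> K \<subseteq> U" if "K \<in> \<D>" for K
    proof -
      obtain c d where cd: "K = {c..d}" using D(3)[OF \<open>K \<in> \<D>\<close>] by auto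
      then have "c < d" using D(3)[OF \<open>K \<in> \<D>\<close>] by auto
      moreover have "a \<le> c" "d \<le> b" using D(2) \<open>K \<in> \<D>\<close> \<open>c < d\<close> cd by fastforce+
      moreover obtain x where "x \<in> N" "K \<subseteq> (if x \<in> U then U else UNIV)" using D(5)[OF \<open>K \<in> \<D>\<close>] by blast
      then have "K \<subseteq> U" using U(2) by (simp add: subsetD)
      ultimately show ?thesis using cd by simp
    qed
    \<comment> \<open>Absolute continuity handles only finite families, but the bound is the same
      for all finite subfamilies and so passes to the countable union.\<close>
    have bound: "measure ?\<mu> (\<Union>\<E>) \<le> \<epsilon>" if \<E>: "\<E> \<subseteq> \<D>" "finite \<E>" for \<E>
    proof -
      have no: "nonoverlapping a b \<E> Inf Sup"
        unfolding nonoverlapping_def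
      proof (intro conjI ballI impI)
        fix A B assume AB: "A \<in> \<E>" "B \<in> \<E>" "A \<noteq> B"
        then have "interior A \<inter> interior B = {}" using D(4) \<E> unfolding pairwise_def by blast
        moreover have "interior A = {Inf A<..<Sup A}" "interior B = {Inf B<..<Sup B}"
          using K AB \<E> interior_atLeastAtMost_real by (metis subsetD)+
        ultimately have disj: "{Inf A<..<Sup A} \<inter> {Inf B<..<Sup B} = {}" by simp
        show "Sup A \<le> Inf B \<or> Sup B \<le> Inf A"
        proof (rule ccontr)
          assume "\<not> ?thesis"
          then have "max (Inf A) (Inf B) < min (Sup A) (Sup B)" using K AB \<E> by (auto simp: max_def)
          then obtain z where "max (Inf A) (Inf B) < z" "z < min (Sup A) (Sup B)" using dense by blast
          then have "z \<in> {Inf A<..<Sup A} \<inter> {Inf B<..<Sup B}" by simp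
          then show False using disj by blast
        qed
      qed (use K \<E> in \<open>auto intro: less_imp_le\<close>)
      have sub: "{Inf A<..<Sup A} \<subseteq> U" if "A \<in> \<E>" for A
      proof -
        have "A = {Inf A..Sup A}" "A \<subseteq> U" using K \<E> that by auto
        moreover have "{Inf A<..<Sup A} \<subseteq> {Inf A..Sup A}" by auto
        ultimately show ?thesis by simp
      qed
      have "(\<Sum>A\<in>\<E>. Sup A - Inf A) < \<delta>"
        using nonoverlapping_length_le[OF no Ufm sub] mU by linarith
      then have inc: "increments F \<E> Inf Sup < \<epsilon>" by (rule \<delta>[OF no])
      have "measure ?\<mu> A = \<bar>F (Sup A) - F (Inf A)\<bar>" if "A \<in> \<E>" for A
      proof -
        have "A = {Inf A..Sup A}" "Inf A \<le> Sup A" using K \<E> that by force+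
        then have "emeasure ?\<mu> A = ennreal (F (Sup A) - F (Inf A))" using Icc by metis
        then show ?thesis using mono[OF \<open>Inf A \<le> Sup A\<close>] by (simp add: measure_def)
      qed
      then have "(\<Sum>A\<in>\<E>. measure ?\<mu> A) = increments F \<E> Inf Sup" by (simp add: increments_def)
      moreover have "measure ?\<mu> (\<Union>\<E>) \<le> (\<Sum>A\<in>\<E>. measure ?\<mu> A)"
      proof (rule measure_Union_le[OF \<E>(2)])
        fix A assume "A \<in> \<E>"
        then have "A = {Inf A..Sup A}" using K \<E> by blast
        then show "A \<in> sets ?\<mu>" by (metis atLeastAtMost_borel sets_interval_measure)
      qed
      ultimately show ?thesis using inc by linarith
    qed
    have fm: "A \<in> fmeasurable ?\<mu>" if "A \<in> \<D>" for A
    proof -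
      have "A = {Inf A..Sup A}" "Inf A \<le> Sup A" using K that by force+
      moreover have "{Inf A..Sup A} \<in> fmeasurable ?\<mu>"
        using Icc[OF \<open>Inf A \<le> Sup A\<close>] by (intro fmeasurableI) auto
      ultimately show ?thesis by simp
    qed
    have "\<Union>\<D> \<in> fmeasurable ?\<mu>" "measure ?\<mu> (\<Union>\<D>) \<le> \<epsilon>"
      using fmeasurable_Union_bound[OF D(1) fm bound] measure_Union_bound[OF D(1) fm bound] by auto
    then have "emeasure ?\<mu> (\<Union>\<D>) \<le> ennreal \<epsilon>"
      by (simp add: emeasure_eq_measure2 ennreal_leI)
    moreover have "emeasure ?\<mu> N \<le> emeasure ?\<mu> (\<Union>\<D>)"
      using D(6) \<open>\<Union>\<D> \<in> fmeasurable ?\<mu>\<close> by (intro emeasure_mono) auto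
    ultimately show ?thesis by (rule order_trans[rotated])
  qed
  have "emeasure ?\<mu> N \<le> 0"
  proof (rule ennreal_le_epsilon)
    fix e :: real assume "0 < e"
    then show "emeasure ?\<mu> N \<le> 0 + ennreal e" using le by simp
  qed
  then show ?thesis by simp
qed

lemma abs_cont_mono_density:
  fixes F :: "real \<Rightarrow> real"
  assumes mono: "\<And>x y. x \<le> y \<Longrightarrow> F x \<le> F y" and cont: "continuous_on UNIV F"
    and ac: "abs_cont_on a b F" and "a < b"
  obtains h :: "real \<Rightarrow> real" where "integrable lborel h"
    "\<And>s t. a \<le> s \<Longrightarrow> s \<le> t \<Longrightarrow> t \<le> b \<Longrightarrow> F t - F s = integral {s..t} h"
proof -
  let ?\<mu> = "interval_measure F"
  have Icc: "emeasure ?\<mu> {c..d} = ennreal (F d - F c)" if "c \<le> d" for c d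
    using emeasure_interval_measure_Icc[OF that mono cont] .
  \<comment> \<open>Outside \<open>[a,b]\<close> the function may have a singular part, so the
    Stieltjes measure is restricted before it is compared with Lebesgue measure.\<close>
  define \<mu> where "\<mu> = density ?\<mu> (indicator {a..b})"
  have em: "emeasure \<mu> A = emeasure ?\<mu> ({a..b} \<inter> A)" if "A \<in> sets borel" for A
    unfolding \<mu>_def using that by (subst emeasure_restricted) auto
  have "absolutely_continuous lborel \<mu>"
    unfolding absolutely_continuous_def
  proof
    fix N :: "real set" assume N: "N \<in> null_sets lborel"
    have "emeasure ?\<mu> ({a..b} \<inter> N) = 0"
    proof (rule interval_measure_null_of_abs_cont[OF mono cont ac \<open>a < b\<close>])
      show "{a..b} \<inter> N \<in> null_sets lborel" using N by (rule null_set_Int1) auto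
    qed auto
    then have "emeasure \<mu> N = 0" using em[of N] null_setsD2[OF N] by simp
    then show "N \<in> null_sets \<mu>" using null_setsD2[OF N] by (auto simp: \<mu>_def)
  qed
  then obtain g where g: "g \<in> borel_measurable lborel" "density lborel g = \<mu>"
    using sigma_finite_measure.Radon_Nikodym[OF sigma_finite_lborel, of \<mu>] by (auto simp: \<mu>_def)
  have gi: "(\<integral>\<^sup>+x. g x * indicator {s..t} x \<partial>lborel) = ennreal (F t - F s)" if "a \<le> s" "s \<le> t" "t \<le> b" for s t
  proof -
    have "{a..b} \<inter> {s..t} = {s..t}" using that by auto
    then have "emeasure (density lborel g) {s..t} = ennreal (F t - F s)"
      unfolding g(2) using em[of "{s..t}"] Icc[of s t] that by simp
    then show ?thesis using g(1) by (simp add: emeasure_density)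
  qed
  \<comment> \<open>The Radon--Nikodym density takes values in \<open>ennreal\<close>. It is finite
    almost everywhere on \<open>[a,b]\<close>, because its integral there is
    \<open>F b - F a\<close>, so \<open>enn2real\<close> alters it only on a null set; the indicator
    makes \<open>h\<close> integrable on the whole line.\<close>
  define h where "h x = enn2real (g x * indicator {a..b} x)" for x
  have hm[measurable]: "h \<in> borel_measurable borel" using g(1) unfolding h_def by simp
  have h_nonneg: "0 \<le> h x" for x by (simp add: h_def)
  have "AE x in lborel. g x * indicator {a..b} x \<noteq> \<infinity>"
    using g(1) gi[of a b] \<open>a < b\<close> by (intro nn_integral_PInf_AE) auto
  then have hg: "AE x in lborel. ennreal (h x) = g x * indicator {a..b} x"
    by eventually_elim (auto simp: h_def top.not_eq_extremum)
  have hi: "has_bochner_integral lborel (\<lambda>x. indicator {s..t} x *\<^sub>R h x) (F t - F s)"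
    if "a \<le> s" "s \<le> t" "t \<le> b" for s t
  proof (rule has_bochner_integral_nn_integral)
    have "(\<integral>\<^sup>+x. ennreal (indicator {s..t} x *\<^sub>R h x) \<partial>lborel) = (\<integral>\<^sup>+x. g x * indicator {s..t} x \<partial>lborel)"
    proof (rule nn_integral_cong_AE)
      show "AE x in lborel. ennreal (indicator {s..t} x *\<^sub>R h x) = g x * indicator {s..t} x"
        using hg
      proof eventually_elim
        case (elim x)
        then show ?case using that by (auto simp: indicator_def split: if_splits)
      qed
    qed
    then show "(\<integral>\<^sup>+x. ennreal (indicator {s..t} x *\<^sub>R h x) \<partial>lborel) = ennreal (F t - F s)"
      using gi[OF that] by simp
  qed (use that mono in \<open>auto simp: h_nonneg\<close>)
  have "(\<lambda>x. indicator {a..b} x *\<^sub>R h x) = h" by (auto simp: h_def indicator_def)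
  then have "integrable lborel h" using hi[of a b] \<open>a < b\<close> by (simp add: has_bochner_integral_iff)
  moreover have "F t - F s = integral {s..t} h" if "a \<le> s" "s \<le> t" "t \<le> b" for s t
    using hi[OF that] set_borel_integral_eq_integral(2)[of "{s..t}" h]
    by (auto simp: has_bochner_integral_iff set_integrable_def set_lebesgue_integral_def)
  ultimately show thesis by (rule that)
qed

lemma abs_cont_on_cong:
  assumes "abs_cont_on a b f" "\<And>t. t \<in> {a..b} \<Longrightarrow> f t = g t"
  shows "abs_cont_on a b g"
  by (rule abs_cont_on_dominated[OF assms(1,1), of _ 1 1]) (use assms(2) in auto)

lemma abs_cont_mono_on_density:
  fixes F :: "real \<Rightarrow> real"
  assumes mono: "\<And>x y. a \<le> x \<Longrightarrow> x \<le> y \<Longrightarrow> y \<le> b \<Longrightarrow> F x \<le> F y" and ac: "abs_cont_on a b F" and "a < b"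
  obtains h :: "real \<Rightarrow> real" where "integrable lborel h"
    "\<And>s t. a \<le> s \<Longrightarrow> s \<le> t \<Longrightarrow> t \<le> b \<Longrightarrow> F t - F s = integral {s..t} h"
proof -
  \<comment> \<open>The Stieltjes measure requires monotonicity and continuity on the whole line, so
    \<open>F\<close> is continued by its endpoint values.\<close>
  define G where "G t = F (max a (min b t))" for t
  have G: "G t = F t" if "a \<le> t" "t \<le> b" for t using that by (simp add: G_def max_def)
  have "abs_cont_on a b G" using ac by (rule abs_cont_on_cong) (simp add: G)
  moreover have "continuous_on UNIV G"
    unfolding G_def using \<open>a < b\<close>
    by (intro continuous_on_compose2[OF abs_cont_on_continuous_on[OF ac]] continuous_intros) auto
  moreover have "G x \<le> G y" if "x \<le> y" for x y
    unfolding G_def using that \<open>a < b\<close> by (intro mono) auto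
  ultimately obtain h where "integrable lborel h"
    "\<And>s t. a \<le> s \<Longrightarrow> s \<le> t \<Longrightarrow> t \<le> b \<Longrightarrow> G t - G s = integral {s..t} h"
    using abs_cont_mono_density[of G a b] \<open>a < b\<close> by blast
  then show thesis using that G by auto
qed

lemma abs_cont_density:
  assumes ac: "abs_cont_on a b f" and "a < b"
  obtains h :: "real \<Rightarrow> real" where "integrable lborel h"
    "\<And>s t. a \<le> s \<Longrightarrow> s \<le> t \<Longrightarrow> t \<le> b \<Longrightarrow> f t - f s = integral {s..t} h"
proof -
  let ?V = "total_variation f a"
  note inc = total_variation_increase[OF ac]
  have mono: "?V s \<le> ?V t" "?V s + f s \<le> ?V t + f t" if "a \<le> s" "s \<le> t" "t \<le> b" for s t
    using inc[OF that] by (auto simp: abs_if split: if_splits)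
  have acV: "abs_cont_on a b ?V" by (rule abs_cont_on_total_variation[OF ac])
  have acVf: "abs_cont_on a b (\<lambda>t. ?V t + f t)"
    by (rule abs_cont_on_dominated[OF acV ac, of _ 1 1]) auto
  obtain g where g: "integrable lborel g" "\<And>s t. a \<le> s \<Longrightarrow> s \<le> t \<Longrightarrow> t \<le> b \<Longrightarrow> ?V t - ?V s = integral {s..t} g"
    using abs_cont_mono_on_density[OF mono(1) acV \<open>a < b\<close>] by blast
  obtain k where k: "integrable lborel k" "\<And>s t. a \<le> s \<Longrightarrow> s \<le> t \<Longrightarrow> t \<le> b \<Longrightarrow>
      (?V t + f t) - (?V s + f s) = integral {s..t} k"
    using abs_cont_mono_on_density[OF mono(2) acVf \<open>a < b\<close>] by blast
  have io: "g integrable_on {s..t}" "k integrable_on {s..t}" for s t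
    using g(1) k(1) integrable_on_lborel integrable_on_subinterval by blast+
  show thesis
  proof (rule that[of "\<lambda>t. k t - g t"])
    show "integrable lborel (\<lambda>t. k t - g t)" using g(1) k(1) by simp
    show "f t - f s = integral {s..t} (\<lambda>t. k t - g t)" if "a \<le> s" "s \<le> t" "t \<le> b" for s t
      using g(2)[OF that] k(2)[OF that] io[of s t] by (simp add: Henstock_Kurzweil_Integration.integral_diff)
  qed
qed

section \<open>Differentiation of indefinite integrals\<close>

lemma integral_has_real_derivative_AE:
  fixes g :: "real \<Rightarrow> real"
  assumes "g integrable_on {a..b}"
  obtains N where "negligible N"
    "\<And>t. a < t \<Longrightarrow> t < b \<Longrightarrow> t \<notin> N \<Longrightarrow> ((\<lambda>s. integral {a..s} g) has_real_derivative g t) (at t)"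
proof -
  \<comment> \<open>Extension by zero, since the differentiation theorem asks for integrability on
    every bounded interval.\<close>
  define G where "G x = (if x \<in> {a..b} then g x else 0)" for x
  have G: "G integrable_on cbox c d" for c d unfolding G_def by (rule integrable_altD(1)[OF assms])
  \<comment> \<open>That theorem controls only averages over \<open>[x, x + h]\<close> with
    \<open>h > 0\<close>. Applied to the reflected function it gives the averages to the left, with
    an exceptional set that has to be reflected back.\<close>
  then have G': "(\<lambda>x. G (- x)) integrable_on cbox c d" for c d
    using integrable_reflect[where f = G and a = "-d" and b = "-c"] by simp
  obtain N1 where N1: "negligible N1" "\<And>x e. x \<notin> N1 \<Longrightarrow> 0 < e \<Longrightarrow>
      \<exists>d>0. \<forall>h. 0 < h \<and> h < d \<longrightarrow> norm (integral (cbox x (x + h *\<^sub>R One)) G /\<^sub>R h ^ DIM(real) - G x) < e"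
    using integrable_ccontinuous_explicit[OF G] by blast
  obtain N2 where N2: "negligible N2" "\<And>x e. x \<notin> N2 \<Longrightarrow> 0 < e \<Longrightarrow>
      \<exists>d>0. \<forall>h. 0 < h \<and> h < d \<longrightarrow>
        norm (integral (cbox x (x + h *\<^sub>R One)) (\<lambda>x. G (- x)) /\<^sub>R h ^ DIM(real) - G (- x)) < e"
    using integrable_ccontinuous_explicit[OF G'] by blast
  have "negligible (uminus ` N2)"
    using N2(1) by (rule negligible_differentiable_image_negligible[OF order_refl])
      (simp add: differentiable_on_def)
  have main: "((\<lambda>s. integral {a..s} g) has_real_derivative g t) (at t)"
    if t: "a < t" "t < b" "t \<notin> N1 \<union> uminus ` N2" for t
    unfolding DERIV_def LIM_eq
  proof (intro allI impI)
    fix e :: real assume "0 < e"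
    have "- t \<notin> N2" using t(3) by force
    obtain d1 where d1: "d1 > 0" "\<And>h. 0 < h \<Longrightarrow> h < d1 \<Longrightarrow> \<bar>integral {t..t+h} G / h - g t\<bar> < e"
      using N1(2)[of t e] t \<open>0 < e\<close> by (auto simp: G_def divide_inverse mult.commute)
    obtain d2 where d2: "d2 > 0" "\<And>h. 0 < h \<Longrightarrow> h < d2 \<Longrightarrow> \<bar>integral {-t..-t+h} (\<lambda>x. G (-x)) / h - g t\<bar> < e"
      using N2(2)[OF \<open>- t \<notin> N2\<close> \<open>0 < e\<close>] t by (auto simp: G_def divide_inverse mult.commute)
    define d where "d = Min {d1, d2, b - t, t - a}"
    have "d > 0" using d1 d2 t by (simp add: d_def)
    have "\<bar>(integral {a..t+h} g - integral {a..t} g) / h - g t\<bar> < e" if h: "h \<noteq> 0" "\<bar>h\<bar> < d" for h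
    proof -
      have ab: "a < t + h" "t + h < b" and h12: "\<bar>h\<bar> < d1" "\<bar>h\<bar> < d2" using h by (auto simp: d_def)
      have cong: "integral {c..e} G = integral {c..e} g" if "a \<le> c" "e \<le> b" for c e
        using that by (intro integral_cong) (auto simp: G_def)
      show ?thesis
      proof (cases "h > 0")
        case True
        have "integral {a..t} g + integral {t..t+h} g = integral {a..t+h} g"
          using True ab t by (intro Henstock_Kurzweil_Integration.integral_combine integrable_on_subinterval[OF assms]) auto
        then have "integral {a..t+h} g - integral {a..t} g = integral {t..t+h} G"
          using cong[of t "t+h"] ab t by simp
        then show ?thesis using d1(2)[of h] True h12 by simp
      next
        case False
        have "integral {a..t+h} g + integral {t+h..t} g = integral {a..t} g"
          using False ab t by (intro Henstock_Kurzweil_Integration.integral_combine integrable_on_subinterval[OF assms]) auto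
        then have "integral {a..t+h} g - integral {a..t} g = - integral {t+h..t} G"
          using cong[of "t+h" t] ab t by simp
        moreover have "integral {-t..-t+(-h)} (\<lambda>x. G (-x)) = integral {t+h..t} G"
          using Henstock_Kurzweil_Integration.integral_reflect_real[of t "t+h" G] by simp
        ultimately show ?thesis using d2(2)[of "-h"] False h h12 by simp
      qed
    qed
    then show "\<exists>s>0. \<forall>x. x \<noteq> 0 \<and> norm (x - 0) < s \<longrightarrow>
        norm ((integral {a..t + x} g - integral {a..t} g) / x - g t) < e"
      using \<open>d > 0\<close> by (intro exI[of _ d]) auto
  qed
  show thesis
    by (rule that[of "N1 \<union> uminus ` N2"]) (use N1(1) \<open>negligible (uminus ` N2)\<close> main in auto)
qed

text \<open>Gauge integrability of \<open>g\<close> suffices, which fits the weak derivative of an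
  admissible function. The same lemma also serves for densities of absolutely continuous functions
  and, with \<open>f = 0\<close>, to show that a function all of whose indefinite integrals vanish
  is zero almost everywhere.\<close>

lemma AE_derivative_of_indefinite_integral:
  fixes f g :: "real \<Rightarrow> real"
  assumes g: "g integrable_on {a..b}" and f: "\<And>t. t \<in> {a..b} \<Longrightarrow> f t = f a + integral {a..t} g"
  shows "AE t in lborel. t \<in> {a<..<b} \<longrightarrow> (f has_real_derivative g t) (at t)"
proof -
  obtain N where N: "negligible N"
    "\<And>t. a < t \<Longrightarrow> t < b \<Longrightarrow> t \<notin> N \<Longrightarrow> ((\<lambda>s. integral {a..s} g) has_real_derivative g t) (at t)"
    using integral_has_real_derivative_AE[OF g] by blast
  have "(f has_real_derivative g t) (at t)" if "t \<in> {a<..<b}" "t \<notin> N" for t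
  proof -
    have deriv: "((\<lambda>s. f a + integral {a..s} g) has_real_derivative g t) (at t)"
      using N(2)[of t] that by (auto intro!: derivative_eq_intros)
    have "eventually (\<lambda>s. s \<in> {a<..<b}) (nhds t)"
      using that by (intro eventually_nhds_in_open) auto
    then have ev: "eventually (\<lambda>s. f a + integral {a..s} g = f s) (nhds t)"
      by eventually_elim (rule f[symmetric], simp)
    show ?thesis using deriv DERIV_cong_ev[OF refl ev refl, of "g t"] by simp
  qed
  moreover have "AE t in lebesgue. t \<notin> N"
    using N(1) by (intro AE_not_in) (simp add: negligible_iff_null_sets)
  ultimately have "AE t in lebesgue. t \<in> {a<..<b} \<longrightarrow> (f has_real_derivative g t) (at t)"
    by (auto elim: eventually_mono)
  then show ?thesis by (simp add: AE_completion_iff)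
qed

theorem abs_cont_on_fundamental:
  assumes ac: "abs_cont_on a b f" and "a < b"
  obtains h :: "real \<Rightarrow> real" where "integrable lborel h"
    "\<And>s t. a \<le> s \<Longrightarrow> s \<le> t \<Longrightarrow> t \<le> b \<Longrightarrow> f t - f s = integral {s..t} h"
    "AE t in lborel. t \<in> {a<..<b} \<longrightarrow> (f has_real_derivative h t) (at t)"
proof -
  obtain h :: "real \<Rightarrow> real" where h: "integrable lborel h"
    "\<And>s t. a \<le> s \<Longrightarrow> s \<le> t \<Longrightarrow> t \<le> b \<Longrightarrow> f t - f s = integral {s..t} h"
    using abs_cont_density[OF assms] by blast
  have "h integrable_on {a..b}"
    using h(1) integrable_on_lborel integrable_on_subinterval by blast
  moreover have "f t = f a + integral {a..t} h" if "t \<in> {a..b}" for t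
    using h(2)[of a t] that by simp
  ultimately have "AE t in lborel. t \<in> {a<..<b} \<longrightarrow> (f has_real_derivative h t) (at t)"
    by (rule AE_derivative_of_indefinite_integral)
  with h show thesis by (rule that)
qed

text \<open>The fundamental theorem for a derivative \<open>d\<close> fixed in advance. The density
  \<open>h\<close> is chosen for one function at a time and carries no measurability in a parameter;
  uniqueness of derivatives replaces it by \<open>d\<close>, which may be a section of a jointly
  measurable function. The endpoints form a null set.\<close>

lemma abs_cont_on_has_bochner_integral:
  assumes ac: "abs_cont_on a b f" and "a \<le> b" and d[measurable]: "d \<in> borel_measurable borel"
    and deriv: "AE t in lborel. t \<in> {a<..<b} \<longrightarrow> (f has_real_derivative d t) (at t)"
  shows "has_bochner_integral lborel (\<lambda>t. indicator {a<..<b} t * d t) (f b - f a)"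
proof (cases "a < b")
  case True
  obtain h :: "real \<Rightarrow> real" where h: "integrable lborel h"
    "\<And>s t. a \<le> s \<Longrightarrow> s \<le> t \<Longrightarrow> t \<le> b \<Longrightarrow> f t - f s = integral {s..t} h"
    "AE t in lborel. t \<in> {a<..<b} \<longrightarrow> (f has_real_derivative h t) (at t)"
    using abs_cont_on_fundamental[OF ac True] by blast
  have [measurable]: "h \<in> borel_measurable borel" using h(1) by auto
  have si: "set_integrable lborel {a..b} h"
    unfolding set_integrable_def using h(1) by (intro integrable_mult_indicator) auto
  have "has_bochner_integral lborel (\<lambda>t. indicator {a..b} t *\<^sub>R h t) (f b - f a)"
    using si h(2)[of a b] True set_borel_integral_eq_integral(2)[OF si]
    by (simp add: has_bochner_integral_iff set_integrable_def set_lebesgue_integral_def)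
  moreover have "AE t in lborel. indicator {a..b} t *\<^sub>R h t = indicator {a<..<b} t * d t"
    using deriv h(3) AE_lborel_singleton[of a] AE_lborel_singleton[of b]
  proof eventually_elim
    case (elim t)
    then show ?case by (auto simp: indicator_def dest: DERIV_unique)
  qed
  ultimately show ?thesis by (subst (asm) has_bochner_integral_cong_AE) auto
next
  case False
  then have "a = b" using \<open>a \<le> b\<close> by simp
  then show ?thesis by (simp add: has_bochner_integral_zero)
qed

section \<open>Measurability of partial derivatives\<close>

text \<open>Continuity allows the increments to be restricted to rationals, which expresses
  differentiability by countably many inequalities. This is what makes the set of differentiability
  points measurable. The quotient is multiplied out, so that the increment 0 needs no
  exception.\<close>

lemma has_real_derivative_iff_rat:
  fixes f :: "real \<Rightarrow> real"
  assumes cont: "continuous_on UNIV f"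
  shows "(f has_real_derivative d) (at t) \<longleftrightarrow> (\<forall>k::nat. \<exists>m::nat. \<forall>r::rat. \<bar>of_rat r\<bar> < 1 / real (Suc m) \<longrightarrow>
    \<bar>f (t + of_rat r) - f t - d * of_rat r\<bar> \<le> \<bar>of_rat r\<bar> / real (Suc k))"
    (is "?L \<longleftrightarrow> ?R")
proof
  assume ?L
  show ?R
  proof
    fix k :: nat
    obtain s where s: "s > 0" "\<And>h. h \<noteq> 0 \<Longrightarrow> \<bar>h\<bar> < s \<Longrightarrow> \<bar>(f (t + h) - f t) / h - d\<bar> < 1 / real (Suc k)"
      using \<open>?L\<close>[unfolded DERIV_def LIM_eq, rule_format, of "1 / real (Suc k)"] by auto
    obtain m where m: "1 / real (Suc m) < s" using s(1) nat_approx_posE by blast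
    have "\<bar>f (t + h) - f t - d * h\<bar> \<le> \<bar>h\<bar> / real (Suc k)" if "\<bar>h\<bar> < 1 / real (Suc m)" for h
    proof (cases "h = 0")
      case False
      have "f (t + h) - f t - d * h = h * ((f (t + h) - f t) / h - d)" using False by (simp add: field_simps)
      then have "\<bar>f (t + h) - f t - d * h\<bar> = \<bar>h\<bar> * \<bar>(f (t + h) - f t) / h - d\<bar>" by (simp add: abs_mult)
      also have "\<dots> \<le> \<bar>h\<bar> * (1 / real (Suc k))"
        using that m by (intro mult_left_mono less_imp_le[OF s(2)[OF False]]) auto
      finally show ?thesis by simp
    qed simp
    then show "\<exists>m::nat. \<forall>r::rat. \<bar>of_rat r\<bar> < 1 / real (Suc m) \<longrightarrow>
      \<bar>f (t + of_rat r) - f t - d * of_rat r\<bar> \<le> \<bar>of_rat r\<bar> / real (Suc k)" by blast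
  qed
next
  assume ?R
  show ?L
    unfolding DERIV_def LIM_eq
  proof (intro allI impI)
    fix e :: real assume "0 < e"
    obtain k where k: "1 / real (Suc k) < e" using \<open>0 < e\<close> nat_approx_posE by blast
    obtain m where m: "\<And>r::rat. \<bar>of_rat r\<bar> < 1 / real (Suc m) \<Longrightarrow>
        \<bar>f (t + of_rat r) - f t - d * of_rat r\<bar> \<le> \<bar>of_rat r\<bar> / real (Suc k)"
      using \<open>?R\<close> by blast
    have le: "\<bar>f (t + h) - f t - d * h\<bar> \<le> \<bar>h\<bar> / real (Suc k)" if h: "\<bar>h\<bar> < 1 / real (Suc m)" for h
    proof (rule ccontr)
      assume nle: "\<not> ?thesis"
      \<comment> \<open>The increments violating the inequality form an open set; if it is nonempty,
        it contains a rational.\<close>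
      define U where "U = {h. \<bar>h\<bar> < 1 / real (Suc m)} \<inter> {h. \<bar>h\<bar> / real (Suc k) < \<bar>f (t + h) - f t - d * h\<bar>}"
      have "open U"
        unfolding U_def
        by (intro open_Int open_Collect_less continuous_intros continuous_on_compose2[OF cont]) auto
      moreover have "h \<in> U" using h nle by (simp add: U_def)
      ultimately obtain \<epsilon> where "\<epsilon> > 0" "ball h \<epsilon> \<subseteq> U" using openE by blast
      obtain r :: rat where "h < of_rat r" "of_rat r < h + \<epsilon>" using of_rat_dense[of h "h + \<epsilon>"] \<open>\<epsilon> > 0\<close> by auto
      then have "of_rat r \<in> U" using \<open>ball h \<epsilon> \<subseteq> U\<close> by (auto simp: dist_real_def)
      then show False using m[of r] by (simp add: U_def)
    qed
    have "\<bar>(f (t + h) - f t) / h - d\<bar> < e" if "h \<noteq> 0" "\<bar>h\<bar> < 1 / real (Suc m)" for h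
    proof -
      have "(f (t + h) - f t) / h - d = (f (t + h) - f t - d * h) / h" using that by (simp add: field_simps)
      then have "\<bar>(f (t + h) - f t) / h - d\<bar> = \<bar>f (t + h) - f t - d * h\<bar> / \<bar>h\<bar>" by (simp add: abs_divide)
      also have "\<dots> \<le> (\<bar>h\<bar> / real (Suc k)) / \<bar>h\<bar>" using le that by (intro divide_right_mono) auto
      also have "\<dots> = 1 / real (Suc k)" using that by simp
      finally show ?thesis using k by linarith
    qed
    then show "\<exists>s>0. \<forall>x. x \<noteq> 0 \<and> norm (x - 0) < s \<longrightarrow> norm ((f (t + x) - f t) / x - d) < e"
      by (intro exI[of _ "1 / real (Suc m)"]) auto
  qed
qed

text \<open>The limit of difference quotients along \<open>1 / real (Suc n)\<close> is measurable as
  a total function; its value where the limit does not exist is irrelevant. Measurability of the set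
  where it is the true derivative is stated separately, because it is what permits exchanging the
  two almost-everywhere quantifiers.\<close>

lemma measurable_partial_derivative:
  fixes q :: "'a \<Rightarrow> real \<Rightarrow> real"
  assumes q: "(\<lambda>(x, t). q x t) \<in> borel_measurable (M \<Otimes>\<^sub>M borel)"
    and cont: "\<And>x. x \<in> space M \<Longrightarrow> continuous_on UNIV (q x)"
  obtains D where "(\<lambda>(x, t). D x t) \<in> borel_measurable (M \<Otimes>\<^sub>M borel)"
    "{z \<in> space (M \<Otimes>\<^sub>M borel). (q (fst z) has_real_derivative D (fst z) (snd z)) (at (snd z))} \<in> sets (M \<Otimes>\<^sub>M borel)"
    "\<And>x t d. (q x has_real_derivative d) (at t) \<Longrightarrow> D x t = d"
proof -
  define D where "D x t = lim (\<lambda>n. (q x (t + 1 / real (Suc n)) - q x t) / (1 / real (Suc n)))" for x t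
  have qc[measurable]: "(\<lambda>z. q (fst z) (snd z + c)) \<in> borel_measurable (M \<Otimes>\<^sub>M borel)" for c
  proof -
    have "(\<lambda>z. (fst z, snd z + c)) \<in> M \<Otimes>\<^sub>M borel \<rightarrow>\<^sub>M M \<Otimes>\<^sub>M borel" by measurable
    from measurable_compose[OF this q] show ?thesis by simp
  qed
  have q0[measurable]: "(\<lambda>z. q (fst z) (snd z)) \<in> borel_measurable (M \<Otimes>\<^sub>M borel)" using qc[of 0] by simp
  have D1: "(\<lambda>z. D (fst z) (snd z)) \<in> borel_measurable (M \<Otimes>\<^sub>M borel)"
    unfolding D_def by measurable
  note D1[measurable]
  have "{z \<in> space (M \<Otimes>\<^sub>M borel). (q (fst z) has_real_derivative D (fst z) (snd z)) (at (snd z))} =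
    {z \<in> space (M \<Otimes>\<^sub>M borel). \<forall>k::nat. \<exists>m::nat. \<forall>r::rat. \<bar>of_rat r\<bar> < 1 / real (Suc m) \<longrightarrow>
      \<bar>q (fst z) (snd z + of_rat r) - q (fst z) (snd z) - D (fst z) (snd z) * of_rat r\<bar> \<le> \<bar>of_rat r\<bar> / real (Suc k)}"
    by (intro Collect_cong conj_cong refl has_real_derivative_iff_rat cont) (auto simp: space_pair_measure)
  also have "\<dots> \<in> sets (M \<Otimes>\<^sub>M borel)" by measurable
  finally have D2: "{z \<in> space (M \<Otimes>\<^sub>M borel). (q (fst z) has_real_derivative D (fst z) (snd z)) (at (snd z))}
    \<in> sets (M \<Otimes>\<^sub>M borel)" .
  have D3: "D x t = d" if "(q x has_real_derivative d) (at t)" for x t d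
  proof -
    have "((\<lambda>h. (q x (t + h) - q x t) / h) \<longlongrightarrow> d) (at 0)" using that by (simp add: DERIV_def)
    moreover have "filterlim (\<lambda>n. 1 / real (Suc n)) (at 0) sequentially"
      using LIMSEQ_inverse_real_of_nat by (simp add: filterlim_at inverse_eq_divide)
    ultimately have "(\<lambda>n. (q x (t + 1 / real (Suc n)) - q x t) / (1 / real (Suc n))) \<longlonglongrightarrow> d"
      by (rule filterlim_compose)
    then show ?thesis unfolding D_def by (rule limI)
  qed
  show thesis by (rule that[of D]) (use D1 D2 D3 in \<open>auto simp: case_prod_beta'\<close>)
qed

section \<open>The information inequality\<close>

text \<open>Inequality of the arithmetic and geometric mean for \<open>q\<close> and
  \<open>D^2 / q\<close>. At \<open>q = 0\<close> the right-hand side is 0 by the convention for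
  division, which forces the assumption on \<open>D\<close>.\<close>

lemma abs_score_le:
  fixes D q :: real
  assumes "0 \<le> q" "q = 0 \<longrightarrow> D = 0"
  shows "\<bar>D\<bar> \<le> (q + D\<^sup>2 / q) / 2"
proof (cases "q = 0")
  case False
  then have "q > 0" using assms by simp
  have "0 \<le> (\<bar>D\<bar> - q)\<^sup>2" by simp
  then have "2 * \<bar>D\<bar> * q \<le> q\<^sup>2 + D\<^sup>2" by (simp add: power2_diff)
  then show ?thesis using \<open>q > 0\<close> by (simp add: field_simps power2_eq_square)
qed (use assms in auto)

lemma score_integrable:
  fixes D q :: "'a \<Rightarrow> real"
  assumes [measurable]: "D \<in> borel_measurable M"
    and q: "has_bochner_integral M q 1" "\<And>x. x \<in> space M \<Longrightarrow> 0 \<le> q x"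
    and I: "has_bochner_integral M (\<lambda>x. (D x)\<^sup>2 / q x) I"
    and zero: "AE x in M. q x = 0 \<longrightarrow> D x = 0"
  shows "integrable M D" "(\<integral>\<^sup>+x. ennreal \<bar>D x\<bar> \<partial>M) \<le> ennreal ((1 + I) / 2)"
proof -
  have b: "has_bochner_integral M (\<lambda>x. (q x + (D x)\<^sup>2 / q x) / 2) ((1 + I) / 2)"
    by (intro has_bochner_integral_divide has_bochner_integral_add q I)
  have le: "AE x in M. \<bar>D x\<bar> \<le> (q x + (D x)\<^sup>2 / q x) / 2"
    using zero AE_space by eventually_elim (rule abs_score_le[OF q(2)])
  show "integrable M D"
    by (rule Bochner_Integration.integrable_bound[OF integrable.intros[OF b]]) (use le in auto)
  have "(\<integral>\<^sup>+x. ennreal \<bar>D x\<bar> \<partial>M) \<le> (\<integral>\<^sup>+x. ennreal ((q x + (D x)\<^sup>2 / q x) / 2) \<partial>M)"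
    using le by (intro nn_integral_mono_AE) (auto intro: ennreal_leI)
  also have "\<dots> = ennreal ((1 + I) / 2)"
  proof -
    have "AE x in M. 0 \<le> (q x + (D x)\<^sup>2 / q x) / 2"
      using AE_space by eventually_elim (use q(2) in auto)
    then show ?thesis using b by (subst nn_integral_eq_integral) (auto simp: has_bochner_integral_iff)
  qed
  finally show "(\<integral>\<^sup>+x. ennreal \<bar>D x\<bar> \<partial>M) \<le> ennreal ((1 + I) / 2)" .
qed

lemma ennreal_le_sqrt:
  assumes "X\<^sup>2 \<le> ennreal K" "0 \<le> K"
  shows "X \<le> ennreal (sqrt K)"
proof (cases X)
  case (real r)
  then have "r\<^sup>2 \<le> K" using assms by (simp add: ennreal_power)
  then show ?thesis using real by (simp add: real_le_rsqrt ennreal_leI)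
next
  case top
  then show ?thesis using assms by (simp add: power2_eq_square ennreal_top_mult top_unique)
qed

text \<open>Cauchy--Schwarz for the factors \<open>e * sqrt q\<close> and
  \<open>(b * q + c * D) / sqrt q\<close>. The square of the second expands into multiples of
  \<open>q\<close>, \<open>D\<close> and \<open>D^2 / q\<close>, with integrals 1, 0 and
  \<open>I\<close>. Bounding the integral of the absolute value yields integrability of the product
  along with the estimate.\<close>

lemma cross_moment_bound:
  fixes D q e :: "'a \<Rightarrow> real"
  assumes [measurable]: "D \<in> borel_measurable M" "q \<in> borel_measurable M" "e \<in> borel_measurable M"
    and q: "has_bochner_integral M q 1" "\<And>x. x \<in> space M \<Longrightarrow> 0 \<le> q x"
    and I: "has_bochner_integral M (\<lambda>x. (D x)\<^sup>2 / q x) I"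
    and zero: "AE x in M. q x = 0 \<longrightarrow> D x = 0"
    and mean: "(\<integral>x. D x \<partial>M) = 0"
    and S: "(\<integral>\<^sup>+x. ennreal ((e x)\<^sup>2 * q x) \<partial>M) \<le> ennreal S" "0 \<le> S"
  shows "(\<integral>\<^sup>+x. ennreal \<bar>e x * (b * q x + c * D x)\<bar> \<partial>M) \<le> ennreal (sqrt S * sqrt (I * c\<^sup>2 + b\<^sup>2))"
proof -
  let ?f = "\<lambda>x. ennreal (\<bar>e x\<bar> * sqrt (q x))" and ?g = "\<lambda>x. ennreal (\<bar>b * q x + c * D x\<bar> / sqrt (q x))"
  have "has_bochner_integral M D 0"
    using score_integrable(1)[OF assms(1) q I zero] mean by (simp add: has_bochner_integral_iff)
  then have "has_bochner_integral M (\<lambda>x. b\<^sup>2 * q x + (2 * b * c) * D x + c\<^sup>2 * ((D x)\<^sup>2 / q x)) (b\<^sup>2 * 1 + (2 * b * c) * 0 + c\<^sup>2 * I)"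
    by (intro has_bochner_integral_add has_bochner_integral_mult_right q I)
  then have sq: "has_bochner_integral M (\<lambda>x. b\<^sup>2 * q x + (2 * b * c) * D x + c\<^sup>2 * ((D x)\<^sup>2 / q x)) (I * c\<^sup>2 + b\<^sup>2)"
    by (simp add: algebra_simps)
  \<comment> \<open>Nonnegativity of the expanded square is recorded together with the identity,
    since it is needed to identify the \<open>nn_integral\<close> with the Bochner integral. Where
    \<open>q\<close> vanishes, so does \<open>D\<close>, and both sides are 0.\<close>
  have eq: "AE x in M. 0 \<le> b\<^sup>2 * q x + (2 * b * c) * D x + c\<^sup>2 * ((D x)\<^sup>2 / q x) \<and>
     (?g x)\<^sup>2 = ennreal (b\<^sup>2 * q x + (2 * b * c) * D x + c\<^sup>2 * ((D x)\<^sup>2 / q x))"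
    using zero AE_space
  proof eventually_elim
    case (elim x)
    show ?case
    proof (cases "q x = 0")
      case False
      then have "q x > 0" using q(2)[OF elim(2)] by simp
      have "b\<^sup>2 * q x + (2 * b * c) * D x + c\<^sup>2 * ((D x)\<^sup>2 / q x) = (b * q x + c * D x)\<^sup>2 / q x"
        using \<open>q x > 0\<close> by (simp add: field_simps power2_eq_square)
      moreover have "(?g x)\<^sup>2 = ennreal ((b * q x + c * D x)\<^sup>2 / q x)"
        using \<open>q x > 0\<close> by (simp add: ennreal_power power_divide)
      ultimately show ?thesis using \<open>q x > 0\<close> by simp
    qed (use elim in auto)
  qed
  have g2: "(\<integral>\<^sup>+x. (?g x)\<^sup>2 \<partial>M) = ennreal (I * c\<^sup>2 + b\<^sup>2)"
  proof -
    have "(\<integral>\<^sup>+x. (?g x)\<^sup>2 \<partial>M) = (\<integral>\<^sup>+x. ennreal (b\<^sup>2 * q x + (2 * b * c) * D x + c\<^sup>2 * ((D x)\<^sup>2 / q x)) \<partial>M)"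
      using eq by (intro nn_integral_cong_AE) (auto elim: eventually_mono)
    also have "\<dots> = ennreal (I * c\<^sup>2 + b\<^sup>2)"
      using eq sq by (subst nn_integral_eq_integral) (auto simp: has_bochner_integral_iff elim: eventually_mono)
    finally show ?thesis .
  qed
  have f2: "(\<integral>\<^sup>+x. (?f x)\<^sup>2 \<partial>M) \<le> ennreal S"
  proof -
    have "(?f x)\<^sup>2 = ennreal ((e x)\<^sup>2 * q x)" if "x \<in> space M" for x
      using q(2)[OF that] by (simp add: ennreal_power power_mult_distrib)
    then have "(\<integral>\<^sup>+x. (?f x)\<^sup>2 \<partial>M) = (\<integral>\<^sup>+x. ennreal ((e x)\<^sup>2 * q x) \<partial>M)"
      by (rule nn_integral_cong)
    then show ?thesis using S(1) by simp
  qed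
  have "(\<integral>\<^sup>+x. ennreal \<bar>e x * (b * q x + c * D x)\<bar> \<partial>M) = (\<integral>\<^sup>+x. ?f x * ?g x \<partial>M)"
  proof (rule nn_integral_cong_AE)
    show "AE x in M. ennreal \<bar>e x * (b * q x + c * D x)\<bar> = ?f x * ?g x"
      using zero AE_space
    proof eventually_elim
      case (elim x)
      show ?case
      proof (cases "q x = 0")
        case False
        then have "q x > 0" using q(2)[OF elim(2)] by simp
        then show ?thesis by (simp add: ennreal_mult'[symmetric] abs_mult)
      qed (use elim in auto)
    qed
  qed
  moreover have "(\<integral>\<^sup>+x. ?f x * ?g x \<partial>M)\<^sup>2 \<le> ennreal S * ennreal (I * c\<^sup>2 + b\<^sup>2)"
  proof -
    have "(\<integral>\<^sup>+x. ?f x * ?g x \<partial>M)\<^sup>2 \<le> (\<integral>\<^sup>+x. (?f x)\<^sup>2 \<partial>M) * (\<integral>\<^sup>+x. (?g x)\<^sup>2 \<partial>M)"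
      by (rule Cauchy_Schwarz_nn_integral) measurable
    also have "\<dots> \<le> ennreal S * ennreal (I * c\<^sup>2 + b\<^sup>2)"
      unfolding g2 by (intro mult_right_mono f2) simp
    finally show ?thesis .
  qed
  moreover have "0 \<le> I"
    using I Bochner_Integration.integral_nonneg[of M "\<lambda>x. (D x)\<^sup>2 / q x"] q(2) by (auto simp: has_bochner_integral_iff)
  ultimately have "(\<integral>\<^sup>+x. ennreal \<bar>e x * (b * q x + c * D x)\<bar> \<partial>M)\<^sup>2 \<le> ennreal (S * (I * c\<^sup>2 + b\<^sup>2))"
    using S(2) by (simp add: ennreal_mult)
  then have "(\<integral>\<^sup>+x. ennreal \<bar>e x * (b * q x + c * D x)\<bar> \<partial>M) \<le> ennreal (sqrt (S * (I * c\<^sup>2 + b\<^sup>2)))"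
    using S(2) \<open>0 \<le> I\<close> by (intro ennreal_le_sqrt) auto
  then show ?thesis by (simp add: real_sqrt_mult)
qed

text \<open>Tonelli in the order that suits the estimates: they hold for fixed \<open>t\<close>
  after integration over \<open>x\<close>, and leave an integrable function of
  \<open>t\<close>.\<close>

lemma (in pair_sigma_finite) integrable_of_section_bound:
  fixes f :: "'a \<Rightarrow> 'b \<Rightarrow> real"
  assumes f: "(\<lambda>z. f (fst z) (snd z)) \<in> borel_measurable (M1 \<Otimes>\<^sub>M M2)" and g: "integrable M2 g"
    and le: "AE y in M2. (\<integral>\<^sup>+x. ennreal \<bar>f x y\<bar> \<partial>M1) \<le> ennreal (g y)"
  shows "integrable (M1 \<Otimes>\<^sub>M M2) (\<lambda>(x, y). f x y)"
proof (rule integrableI_bounded)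
  show "(\<lambda>(x, y). f x y) \<in> borel_measurable (M1 \<Otimes>\<^sub>M M2)" using f by (simp add: case_prod_beta')
  have "(\<integral>\<^sup>+z. ennreal (norm (case z of (x, y) \<Rightarrow> f x y)) \<partial>(M1 \<Otimes>\<^sub>M M2)) =
      (\<integral>\<^sup>+y. (\<integral>\<^sup>+x. ennreal \<bar>f x y\<bar> \<partial>M1) \<partial>M2)"
    using f by (subst nn_integral_snd[symmetric]) (auto simp: case_prod_beta')
  also have "\<dots> \<le> (\<integral>\<^sup>+y. ennreal (g y) \<partial>M2)"
    using le by (rule nn_integral_mono_AE)
  also have "\<dots> \<le> (\<integral>\<^sup>+y. ennreal (norm (g y)) \<partial>M2)"
    by (intro nn_integral_mono ennreal_leI) simp
  also have "\<dots> < \<infinity>" using g by (simp add: integrable_iff_bounded)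
  finally show "(\<integral>\<^sup>+z. ennreal (norm (case z of (x, y) \<Rightarrow> f x y)) \<partial>(M1 \<Otimes>\<^sub>M M2)) < \<infinity>" .
qed

lemma integrable_continuous_open_interval:
  fixes f :: "real \<Rightarrow> real"
  assumes "continuous_on {a..b} f"
  shows "integrable lborel (\<lambda>t. indicator {a<..<b} t * f t)"
proof -
  have "set_integrable lborel {a..b} f" by (rule borel_integrable_atLeastAtMost'[OF assms])
  then have "set_integrable lborel {a<..<b} f" by (rule set_integrable_subset) auto
  then show ?thesis by (simp add: set_integrable_def)
qed

lemma integral_open_interval_eq:
  fixes f :: "real \<Rightarrow> real"
  assumes "integrable lborel (\<lambda>t. indicator {a<..<b} t * f t)"
  shows "integral {a..b} f = (\<integral>t. indicator {a<..<b} t * f t \<partial>lborel)"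
proof -
  have "set_integrable lborel {a<..<b} f" using assms by (simp add: set_integrable_def)
  from set_borel_integral_eq_integral(2)[OF this]
  show ?thesis by (simp add: set_lebesgue_integral_def integral_open_interval_real)
qed

text \<open>Here \<open>q\<close> is a version of the density that is absolutely continuous in \<open>t\<close> for every \<open>x\<close>, and \<open>D\<close> a jointly
  measurable version of its \<open>t\<close>-derivative.\<close>
locale smooth_model = sigma_finite_measure \<nu> for \<nu> :: "'a measure" +
  fixes q D :: "'a \<Rightarrow> real \<Rightarrow> real" and t1 t2 :: real and I :: "real \<Rightarrow> real"
  assumes less: "t1 < t2"
    and q_meas: "(\<lambda>z. q (fst z) (snd z)) \<in> borel_measurable (\<nu> \<Otimes>\<^sub>M lborel)"
    and D_meas: "(\<lambda>z. D (fst z) (snd z)) \<in> borel_measurable (\<nu> \<Otimes>\<^sub>M lborel)"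
    and q_nonneg: "\<And>x t. x \<in> space \<nu> \<Longrightarrow> 0 \<le> q x t"
    and q_ac: "\<And>x. x \<in> space \<nu> \<Longrightarrow> abs_cont_on t1 t2 (q x)"
    and q_prob: "\<And>t. t \<in> {t1..t2} \<Longrightarrow> has_bochner_integral \<nu> (\<lambda>x. q x t) 1"
    and deriv_xt: "AE x in \<nu>. AE t in lborel. t \<in> {t1<..<t2} \<longrightarrow> (q x has_real_derivative D x t) (at t)"
    and deriv_tx: "AE t in lborel. AE x in \<nu>. t \<in> {t1<..<t2} \<longrightarrow> (q x has_real_derivative D x t) (at t)"
    and I_cont: "continuous_on {t1..t2} I"
    and I_int: "AE t in lborel. t \<in> {t1<..<t2} \<longrightarrow> has_bochner_integral \<nu> (\<lambda>x. (D x t)\<^sup>2 / q x t) (I t)"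
begin

sublocale pair_sigma_finite \<nu> lborel ..

lemma sections_measurable:
  shows "(\<lambda>x. q x t) \<in> borel_measurable \<nu>" "(\<lambda>x. D x t) \<in> borel_measurable \<nu>"
    and "x \<in> space \<nu> \<Longrightarrow> q x \<in> borel_measurable borel" "x \<in> space \<nu> \<Longrightarrow> D x \<in> borel_measurable borel"
  using measurable_Pair1[OF q_meas, of t] measurable_Pair1[OF D_meas, of t]
    measurable_Pair2[OF q_meas, of x] measurable_Pair2[OF D_meas, of x] by simp_all

text \<open>A zero of \<open>q x\<close> is a minimum, because \<open>q x\<close> is nonnegative on
  the whole line; hence any radius, such as 1, serves in the local minimum test. Without this, the
  Fisher information could miss mass of \<open>D\<close> where \<open>q\<close> vanishes.\<close>

lemma derivative_zero: "AE t in lborel. AE x in \<nu>. t \<in> {t1<..<t2} \<longrightarrow> q x t = 0 \<longrightarrow> D x t = 0"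
  using deriv_tx
proof eventually_elim
  case (elim t)
  from elim AE_space show ?case
  proof eventually_elim
    case (elim x)
    show ?case
    proof (intro impI)
      assume "t \<in> {t1<..<t2}" "q x t = 0"
      with elim have "(q x has_real_derivative D x t) (at t)" by simp
      then show "D x t = 0"
        by (rule DERIV_local_min[of _ _ _ 1]) (use \<open>q x t = 0\<close> elim(2) q_nonneg in auto)
    qed
  qed
qed

lemma score_bound:
  "AE t in lborel. (\<integral>\<^sup>+x. ennreal \<bar>indicator {t1<..<t2} t * D x t\<bar> \<partial>\<nu>) \<le> ennreal (indicator {t1<..<t2} t * ((1 + I t) / 2))"
  using derivative_zero I_int
proof eventually_elim
  case (elim t)
  show ?case
  proof (cases "t \<in> {t1<..<t2}")
    case True
    then show ?thesis
      using score_integrable(2)[OF sections_measurable(2) q_prob q_nonneg, of t t "I t"] elim by simp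
  qed simp
qed

lemma integrable_derivative:
  "integrable (\<nu> \<Otimes>\<^sub>M lborel) (\<lambda>(x, t). indicator {t1<..<t2} t * D x t)"
proof (rule integrable_of_section_bound[OF _ _ score_bound])
  show "(\<lambda>z. indicator {t1<..<t2} (snd z) * D (fst z) (snd z)) \<in> borel_measurable (\<nu> \<Otimes>\<^sub>M lborel)"
    using D_meas by measurable
  show "integrable lborel (\<lambda>t. indicator {t1<..<t2} t * ((1 + I t) / 2))"
    using I_cont by (intro integrable_continuous_open_interval continuous_intros) auto
qed

text \<open>Differentiating the total mass under the integral at a fixed \<open>t\<close> is not
  justified. Integrated over \<open>[t1,s]\<close>, however, Fubini turns the mean of
  \<open>D\<close> into the difference of the total masses at \<open>s\<close> and
  \<open>t1\<close>, which is 0 for every \<open>s\<close>; this determines the mean for almost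
  every \<open>t\<close>.\<close>

lemma score_mean_zero: "AE t in lborel. t \<in> {t1<..<t2} \<longrightarrow> (\<integral>x. D x t \<partial>\<nu>) = 0"
proof -
  define m where "m t = (\<integral>x. indicator {t1<..<t2} t * D x t \<partial>\<nu>)" for t
  have m: "integrable lborel m"
    unfolding m_def using integrable_snd[OF integrable_derivative] .
  have zero: "integral {t1..s} m = 0" if s: "s \<in> {t1..t2}" for s
  proof -
    have ind: "indicator {t1<..<s} t * (indicator {t1<..<t2} t * y) = indicator {t1<..<s} t * y" for t y :: real
      using s by (auto simp: indicator_def)
    have "integrable (\<nu> \<Otimes>\<^sub>M lborel) (\<lambda>z. indicator (space \<nu> \<times> {t1<..<s}) z *\<^sub>R (case z of (x, t) \<Rightarrow> indicator {t1<..<t2} t * D x t))"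
      by (intro integrable_mult_indicator integrable_derivative) auto
    also have "?this \<longleftrightarrow> integrable (\<nu> \<Otimes>\<^sub>M lborel) (\<lambda>(x, t). indicator {t1<..<s} t * D x t)"
      using s by (intro Bochner_Integration.integrable_cong refl) (auto simp: indicator_def space_pair_measure)
    finally have int: "integrable (\<nu> \<Otimes>\<^sub>M lborel) (\<lambda>(x, t). indicator {t1<..<s} t * D x t)" .
    have mi: "integrable lborel (\<lambda>t. indicator {t1<..<s} t * m t)"
      using integrable_mult_indicator[OF _ m, of "{t1<..<s}"] by simp
    have "integral {t1..s} m = (\<integral>t. indicator {t1<..<s} t * m t \<partial>lborel)"
      by (rule integral_open_interval_eq[OF mi])
    also have "\<dots> = (\<integral>t. (\<integral>x. indicator {t1<..<s} t * D x t \<partial>\<nu>) \<partial>lborel)"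
      unfolding m_def by (simp only: integral_mult_right_zero[symmetric] ind)
    also have "\<dots> = (\<integral>x. (\<integral>t. indicator {t1<..<s} t * D x t \<partial>lborel) \<partial>\<nu>)"
      by (rule Fubini_integral[OF int])
    also have "\<dots> = (\<integral>x. q x s - q x t1 \<partial>\<nu>)"
    proof (rule integral_cong_AE)
      show "(\<lambda>x. \<integral>t. indicator {t1<..<s} t * D x t \<partial>lborel) \<in> borel_measurable \<nu>"
        using integrable_fst[OF int] by auto
      show "(\<lambda>x. q x s - q x t1) \<in> borel_measurable \<nu>"
        using sections_measurable(1) by measurable
      show "AE x in \<nu>. (\<integral>t. indicator {t1<..<s} t * D x t \<partial>lborel) = q x s - q x t1"
        using deriv_xt AE_space
      proof eventually_elim
        case (elim x)
        have "AE t in lborel. t \<in> {t1<..<s} \<longrightarrow> (q x has_real_derivative D x t) (at t)"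
          using elim(1) by eventually_elim (use s in auto)
        then have "has_bochner_integral lborel (\<lambda>t. indicator {t1<..<s} t * D x t) (q x s - q x t1)"
          using s elim(2) by (intro abs_cont_on_has_bochner_integral sections_measurable abs_cont_on_subset[OF q_ac]) auto
        then show ?case by (simp add: has_bochner_integral_iff)
      qed
    qed
    also have "\<dots> = 0"
      using q_prob[of s] q_prob[of t1] s less by (auto simp: has_bochner_integral_iff)
    finally show ?thesis .
  qed
  have "m integrable_on {t1..t2}"
    using m integrable_on_lborel integrable_on_subinterval by blast
  \<comment> \<open>The zero function is an indefinite integral of \<open>m\<close>, so its
    derivative is \<open>m t\<close> almost everywhere.\<close>
  then have "AE t in lborel. t \<in> {t1<..<t2} \<longrightarrow> ((\<lambda>_. 0) has_real_derivative m t) (at t)"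
    by (rule AE_derivative_of_indefinite_integral) (simp add: zero)
  then show ?thesis
  proof eventually_elim
    case (elim t)
    show ?case
    proof
      assume t: "t \<in> {t1<..<t2}"
      then have "m t = 0" using elim DERIV_unique[OF _ DERIV_const] by blast
      then show "(\<integral>x. D x t \<partial>\<nu>) = 0" using t by (simp add: m_def)
    qed
  qed
qed

text \<open>\<open>\<beta>\<close> is a Borel version of the weak derivative, which itself is only Lebesgue measurable.\<close>
lemma weighted_bound:
  fixes \<alpha> \<beta> K :: "real \<Rightarrow> real" and th :: "'a \<Rightarrow> real"
  assumes th[measurable]: "th \<in> borel_measurable \<nu>"
    and risk: "\<And>t. t \<in> {t1<..<t2} \<Longrightarrow> (\<integral>\<^sup>+x. ennreal ((th x - t)\<^sup>2 * q x t) \<partial>\<nu>) \<le> ennreal S" "0 \<le> S"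
    and \<alpha>: "abs_cont_on t1 t2 \<alpha>" "\<alpha> t1 = 0" "\<alpha> t2 = 0" and \<alpha>_meas[measurable]: "\<alpha> \<in> borel_measurable borel"
    and \<beta>[measurable]: "\<beta> \<in> borel_measurable borel"
    and deriv: "AE t in lborel. t \<in> {t1<..<t2} \<longrightarrow> (\<alpha> has_real_derivative \<beta> t) (at t)"
    and K: "integrable lborel (\<lambda>t. indicator {t1<..<t2} t * K t)"
      "AE t in lborel. t \<in> {t1<..<t2} \<longrightarrow> K t = sqrt (I t * (\<alpha> t)\<^sup>2 + (\<beta> t)\<^sup>2)"
  shows "\<bar>\<integral>t. indicator {t1<..<t2} t * \<alpha> t \<partial>lborel\<bar> \<le> sqrt S * (\<integral>t. indicator {t1<..<t2} t * K t \<partial>lborel)"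
proof -
  let ?\<chi> = "indicator {t1<..<t2} :: real \<Rightarrow> real"
  note [measurable] = q_meas D_meas sections_measurable(1,2)
  \<comment> \<open>On the open interval \<open>R - A\<close> is almost everywhere the
    \<open>t\<close>-derivative of \<open>(th x - t) * (\<alpha> t * q x t)\<close>:
    \<open>A\<close> comes from differentiating the factor \<open>th x - t\<close>, and
    \<open>R\<close> from the other two factors.\<close>
  define R where "R x t = ?\<chi> t * ((th x - t) * (\<beta> t * q x t + \<alpha> t * D x t))" for x t
  define A where "A x t = ?\<chi> t * (\<alpha> t * q x t)" for x t
  \<comment> \<open>This serves twice: it gives integrability of \<open>R\<close> on the product
    space, hence Fubini, and it is the final estimate.\<close>
  have R_bound: "AE t in lborel. (\<integral>\<^sup>+x. ennreal \<bar>R x t\<bar> \<partial>\<nu>) \<le> ennreal (sqrt S * (?\<chi> t * K t))"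
    using derivative_zero I_int score_mean_zero K(2)
  proof eventually_elim
    case (elim t)
    show ?case
    proof (cases "t \<in> {t1<..<t2}")
      case True
      have "(\<integral>\<^sup>+x. ennreal \<bar>(th x - t) * (\<beta> t * q x t + \<alpha> t * D x t)\<bar> \<partial>\<nu>) \<le>
          ennreal (sqrt S * sqrt (I t * (\<alpha> t)\<^sup>2 + (\<beta> t)\<^sup>2))"
        using True elim risk(1)[OF True] risk(2) q_prob[of t]
        by (intro cross_moment_bound q_nonneg) (auto)
      then show ?thesis using True elim by (simp add: R_def)
    qed (simp add: R_def)
  qed
  have intR: "integrable (\<nu> \<Otimes>\<^sub>M lborel) (\<lambda>(x, t). R x t)"
  proof (rule integrable_of_section_bound[OF _ _ R_bound])
    show "(\<lambda>z. R (fst z) (snd z)) \<in> borel_measurable (\<nu> \<Otimes>\<^sub>M lborel)" unfolding R_def by measurable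
    show "integrable lborel (\<lambda>t. sqrt S * (?\<chi> t * K t))" using K(1) by simp
  qed
  have \<alpha>_int: "integrable lborel (\<lambda>t. ?\<chi> t * \<alpha> t)"
    by (intro integrable_continuous_open_interval abs_cont_on_continuous_on \<alpha>)
  have A_section: "has_bochner_integral \<nu> (\<lambda>x. A x t) (?\<chi> t * \<alpha> t)" for t
  proof (cases "t \<in> {t1<..<t2}")
    case True
    then have "has_bochner_integral \<nu> (\<lambda>x. \<alpha> t * q x t) (\<alpha> t * 1)"
      by (intro has_bochner_integral_mult_right q_prob) auto
    then show ?thesis using True by (simp add: A_def)
  qed (simp add: A_def has_bochner_integral_zero)
  have intA: "integrable (\<nu> \<Otimes>\<^sub>M lborel) (\<lambda>(x, t). A x t)"
  proof (rule integrable_of_section_bound)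
    show "(\<lambda>z. A (fst z) (snd z)) \<in> borel_measurable (\<nu> \<Otimes>\<^sub>M lborel)" unfolding A_def by measurable
    show "integrable lborel (\<lambda>t. \<bar>?\<chi> t * \<alpha> t\<bar>)" using \<alpha>_int by (rule integrable_abs)
    show "AE t in lborel. (\<integral>\<^sup>+x. ennreal \<bar>A x t\<bar> \<partial>\<nu>) \<le> ennreal \<bar>?\<chi> t * \<alpha> t\<bar>"
    proof (rule AE_I2)
      fix t
      have "(\<integral>\<^sup>+x. ennreal \<bar>A x t\<bar> \<partial>\<nu>) = ennreal (\<integral>x. \<bar>A x t\<bar> \<partial>\<nu>)"
        using A_section[of t] by (intro nn_integral_eq_integral integrable_abs) (auto simp: has_bochner_integral_iff)
      also have "(\<integral>x. \<bar>A x t\<bar> \<partial>\<nu>) = (\<integral>x. ?\<chi> t * \<bar>\<alpha> t\<bar> * q x t \<partial>\<nu>)"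
        by (intro Bochner_Integration.integral_cong refl) (simp add: A_def abs_mult q_nonneg)
      also have "\<dots> = \<bar>?\<chi> t * \<alpha> t\<bar>"
        using q_prob[of t] by (cases "t \<in> {t1<..<t2}") (auto simp: has_bochner_integral_iff)
      finally show "(\<integral>\<^sup>+x. ennreal \<bar>A x t\<bar> \<partial>\<nu>) \<le> ennreal \<bar>?\<chi> t * \<alpha> t\<bar>" by simp
    qed
  qed
  have parts: "AE x in \<nu>. (\<integral>t. R x t - A x t \<partial>lborel) = 0"
    using deriv_xt AE_space
  proof eventually_elim
    case (elim x)
    note [measurable] = sections_measurable(3,4)[OF elim(2)]
    let ?F = "\<lambda>t. (th x - t) * (\<alpha> t * q x t)"
    have "abs_cont_on t1 t2 (\<lambda>t. th x - t)"
      by (rule abs_cont_on_dominated[OF abs_cont_on_ident abs_cont_on_ident, of _ _ _ 1 1]) auto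
    then have "abs_cont_on t1 t2 ?F" by (intro abs_cont_on_mult \<alpha>(1) q_ac elim)
    moreover have "AE t in lborel. t \<in> {t1<..<t2} \<longrightarrow>
        (?F has_real_derivative ((th x - t) * (\<beta> t * q x t + \<alpha> t * D x t) - \<alpha> t * q x t)) (at t)"
      using elim(1) deriv
    proof eventually_elim
      case (elim t)
      show ?case
      proof
        assume "t \<in> {t1<..<t2}"
        with elim have "(q x has_real_derivative D x t) (at t)" "(\<alpha> has_real_derivative \<beta> t) (at t)" by auto
        then show "(?F has_real_derivative ((th x - t) * (\<beta> t * q x t + \<alpha> t * D x t) - \<alpha> t * q x t)) (at t)"
          by (auto intro!: derivative_eq_intros simp: algebra_simps)
      qed
    qed
    ultimately have "has_bochner_integral lborel
        (\<lambda>t. ?\<chi> t * ((th x - t) * (\<beta> t * q x t + \<alpha> t * D x t) - \<alpha> t * q x t)) (?F t2 - ?F t1)"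
      using less by (intro abs_cont_on_has_bochner_integral) auto
    moreover have "(\<lambda>t. ?\<chi> t * ((th x - t) * (\<beta> t * q x t + \<alpha> t * D x t) - \<alpha> t * q x t)) = (\<lambda>t. R x t - A x t)"
      by (simp add: R_def A_def right_diff_distrib)
    ultimately show ?case using \<alpha>(2,3) by (simp add: has_bochner_integral_iff)
  qed
  have int: "integrable (\<nu> \<Otimes>\<^sub>M lborel) (\<lambda>(x, t). R x t - A x t)"
    using Bochner_Integration.integrable_diff[OF intR intA] by (simp add: case_prod_beta')
  have "(\<integral>t. (\<integral>x. R x t - A x t \<partial>\<nu>) \<partial>lborel) = (\<integral>x. (\<integral>t. R x t - A x t \<partial>lborel) \<partial>\<nu>)"
    by (rule Fubini_integral[OF int])
  also have "\<dots> = 0"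
    using parts integrable_fst[OF int] by (intro integral_eq_zero_AE)
  finally have zero: "(\<integral>t. (\<integral>x. R x t - A x t \<partial>\<nu>) \<partial>lborel) = 0" .
  \<comment> \<open>Every \<open>t\<close>-section of \<open>A\<close> is integrable over
    \<open>x\<close>, but those of \<open>R\<close> only almost every one; there the inner integral
    of the difference may be split.\<close>
  have R_AE: "AE t in lborel. integrable \<nu> (\<lambda>x. R x t)"
    using AE_integrable_snd[OF intR] .
  have Rm: "integrable lborel (\<lambda>t. \<integral>x. R x t \<partial>\<nu>)"
    by (rule integrable_snd[OF intR])
  have dm: "integrable lborel (\<lambda>t. \<integral>x. R x t - A x t \<partial>\<nu>)"
    by (rule integrable_snd[OF int])
  have "(\<integral>t. (\<integral>x. R x t - A x t \<partial>\<nu>) \<partial>lborel) = (\<integral>t. (\<integral>x. R x t \<partial>\<nu>) - ?\<chi> t * \<alpha> t \<partial>lborel)"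
  proof (rule integral_cong_AE)
    show "AE t in lborel. (\<integral>x. R x t - A x t \<partial>\<nu>) = (\<integral>x. R x t \<partial>\<nu>) - ?\<chi> t * \<alpha> t"
      using R_AE
    proof eventually_elim
      case (elim t)
      then show ?case using A_section[of t] by (simp add: has_bochner_integral_iff)
    qed
  qed (use dm Rm in auto)
  also have "\<dots> = (\<integral>t. (\<integral>x. R x t \<partial>\<nu>) \<partial>lborel) - (\<integral>t. ?\<chi> t * \<alpha> t \<partial>lborel)"
    using Rm \<alpha>_int by (rule Bochner_Integration.integral_diff)
  finally have "(\<integral>t. ?\<chi> t * \<alpha> t \<partial>lborel) = (\<integral>t. (\<integral>x. R x t \<partial>\<nu>) \<partial>lborel)" using zero by simp
  also have "\<bar>\<dots>\<bar> \<le> (\<integral>t. \<bar>\<integral>x. R x t \<partial>\<nu>\<bar> \<partial>lborel)"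
    by (rule integral_abs_bound)
  also have "\<dots> \<le> (\<integral>t. sqrt S * (?\<chi> t * K t) \<partial>lborel)"
  proof (rule integral_mono_AE)
    show "AE t in lborel. \<bar>\<integral>x. R x t \<partial>\<nu>\<bar> \<le> sqrt S * (?\<chi> t * K t)"
      using R_bound R_AE K(2) I_int
    proof eventually_elim
      case (elim t)
      have "ennreal \<bar>\<integral>x. R x t \<partial>\<nu>\<bar> \<le> (\<integral>\<^sup>+x. ennreal \<bar>R x t\<bar> \<partial>\<nu>)"
        using integral_norm_bound_ennreal[OF elim(2)] by simp
      also have "\<dots> \<le> ennreal (sqrt S * (?\<chi> t * K t))" by (rule elim(1))
      finally have le: "ennreal \<bar>\<integral>x. R x t \<partial>\<nu>\<bar> \<le> ennreal (sqrt S * (?\<chi> t * K t))" .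
      \<comment> \<open>\<open>ennreal\<close> sends negative reals to 0, so the inequality returns
        to the reals only with a nonnegative right-hand side.\<close>
      have "0 \<le> ?\<chi> t * K t"
      proof (cases "t \<in> {t1<..<t2}")
        case True
        then have "0 \<le> I t"
          using elim(4) Bochner_Integration.integral_nonneg[of \<nu> "\<lambda>x. (D x t)\<^sup>2 / q x t"] q_nonneg
          by (auto simp: has_bochner_integral_iff)
        then show ?thesis using True elim(3) by simp
      qed simp
      then have "0 \<le> sqrt S * (?\<chi> t * K t)" using risk(2) by simp
      then show ?case using le by (simp add: ennreal_le_iff)
    qed
  qed (use Rm K(1) in auto)
  finally show ?thesis by simp
qed

end

section \<open>From the given densities to a smooth model\<close>

lemma abs_cont_on_const: "abs_cont_on a b (\<lambda>_. c)"
  by (rule abs_cont_on_dominated[OF abs_cont_on_ident abs_cont_on_ident, of _ _ _ 1 1]) auto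

text \<open>At interior points differentiation within \<open>[t1,t2]\<close> is ordinary
  differentiation, and only values near \<open>t\<close> matter. This lets the Fisher information of
  \<open>p\<close> be computed from a version that differs from \<open>p\<close> beyond the
  endpoints.\<close>

lemma pdt_eq_derivative:
  assumes "t \<in> {t1<..<t2}" "(f has_real_derivative d) (at t)" "\<And>s. s \<in> {t1..t2} \<Longrightarrow> f s = p x s"
  shows "pdt p t1 t2 x t = d"
proof -
  have "eventually (\<lambda>s. s \<in> {t1<..<t2}) (nhds t)"
    using assms(1) by (intro eventually_nhds_in_open) auto
  then have ev: "eventually (\<lambda>s. f s = p x s) (nhds t)"
    by eventually_elim (use assms(3) in auto)
  have "(p x has_real_derivative d) (at t)"
    using assms(2) DERIV_cong_ev[OF refl ev refl, of d] by simp
  then have vd: "(p x has_vector_derivative d) (at t)"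
    by (simp add: has_real_derivative_iff_has_vector_derivative)
  have "at t within {t1..t2} = at t" using assms(1) by (intro at_within_Icc_at) auto
  then show ?thesis
    using vd differentiableI_vector[OF vd] by (simp add: pdt_def vector_derivative_at)
qed

text \<open>For each \<open>t\<close> in the interval the version differs from \<open>p\<close> only
  on one fixed null set of \<open>x\<close>, so total mass, risk and, in the interior, Fisher
  information are preserved.\<close>

lemma smooth_model_of_density:
  fixes \<nu> :: "'a measure" and p :: "'a \<Rightarrow> real \<Rightarrow> real"
  assumes sf: "sigma_finite_measure \<nu>" and less: "t1 < t2"
    and p_meas: "(\<lambda>(x, t). p x t) \<in> borel_measurable (\<nu> \<Otimes>\<^sub>M restrict_space borel {t1..t2})"
    and p_nonneg: "\<And>t x. t \<in> {t1..t2} \<Longrightarrow> x \<in> space \<nu> \<Longrightarrow> 0 \<le> p x t"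
    and p_dens: "\<And>t. t \<in> {t1..t2} \<Longrightarrow> (\<integral>\<^sup>+ x. ennreal (p x t) \<partial>\<nu>) = 1"
    and p_ac: "AE x in \<nu>. abs_cont_on t1 t2 (\<lambda>t. p x t)"
    and I_fin: "\<And>t. t \<in> {t1..t2} \<Longrightarrow> integrable \<nu> (\<lambda>x. (pdt p t1 t2 x t)\<^sup>2 / p x t)"
    and I_ac: "abs_cont_on t1 t2 (fisher_info \<nu> p t1 t2)"
  obtains q D where "smooth_model \<nu> q D t1 t2 (fisher_info \<nu> p t1 t2)"
    "\<forall>t\<in>{t1..t2}. AE x in \<nu>. q x t = p x t"
proof -
  interpret sigma_finite_measure \<nu> by (rule sf)
  interpret pair_sigma_finite \<nu> lborel ..
  define c where "c t = max t1 (min t2 t)" for t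
  have c_in: "c t \<in> {t1..t2}" for t using less by (auto simp: c_def)
  have c_id: "c t = t" if "t \<in> {t1..t2}" for t using that by (auto simp: c_def)
  obtain N where N: "{x \<in> space \<nu>. \<not> abs_cont_on t1 t2 (\<lambda>t. p x t)} \<subseteq> N" "N \<in> null_sets \<nu>"
    using AE_E[OF p_ac] by (metis null_setsI)
  have notN: "AE x in \<nu>. x \<in> space \<nu> - N"
    using AE_not_in[OF N(2)] AE_space by eventually_elim simp
  \<comment> \<open>On the exceptional null set the zero function is nonnegative and absolutely
    continuous, so both properties now hold for every \<open>x\<close>. Clamping \<open>t\<close> by
    \<open>c\<close> makes sense of \<open>q x\<close> on the whole line.\<close>
  define q where "q x t = indicator (space \<nu> - N) x * p x (c t)" for x t
  have qp: "q x t = p x t" if "x \<in> space \<nu> - N" "t \<in> {t1..t2}" for x t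
    using that by (simp add: q_def c_id)
  have q_AE: "AE x in \<nu>. q x t = p x t" if "t \<in> {t1..t2}" for t
    using notN by eventually_elim (rule qp[OF _ that])
  have p_section[measurable]: "(\<lambda>x. p x t) \<in> borel_measurable \<nu>" if "t \<in> {t1..t2}" for t
    using measurable_Pair1[OF p_meas, of t] that by (simp add: space_restrict_space)
  have q_meas: "(\<lambda>z. q (fst z) (snd z)) \<in> borel_measurable (\<nu> \<Otimes>\<^sub>M borel)"
  proof -
    have "c \<in> borel \<rightarrow>\<^sub>M restrict_space borel {t1..t2}"
    proof (rule measurable_restrict_space2)
      show "c \<in> borel_measurable borel" unfolding c_def by measurable
    qed (use c_in in auto)
    then have "(\<lambda>z. (fst z, c (snd z))) \<in> \<nu> \<Otimes>\<^sub>M borel \<rightarrow>\<^sub>M \<nu> \<Otimes>\<^sub>M restrict_space borel {t1..t2}"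
      by measurable
    from measurable_compose[OF this p_meas]
    have [measurable]: "(\<lambda>z. p (fst z) (c (snd z))) \<in> borel_measurable (\<nu> \<Otimes>\<^sub>M borel)" by simp
    have [measurable]: "N \<in> sets \<nu>" using N(2) by auto
    show ?thesis unfolding q_def by measurable
  qed
  have q_nonneg: "0 \<le> q x t" if "x \<in> space \<nu>" for x t
    using p_nonneg[OF c_in that] by (simp add: q_def)
  have q_zero: "q x = (\<lambda>_. 0)" if "x \<notin> space \<nu> - N" for x
    using that by (auto simp: q_def fun_eq_iff)
  have q_ac: "abs_cont_on t1 t2 (q x)" for x
  proof (cases "x \<in> space \<nu> - N")
    case True
    then have "abs_cont_on t1 t2 (p x)" using N(1) by auto
    then show ?thesis by (rule abs_cont_on_cong) (simp add: qp[OF True])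
  qed (simp add: q_zero abs_cont_on_const)
  \<comment> \<open>Continuity on the whole line, as the rational test for differentiability
    requires, holds because \<open>q x\<close> is constant beyond the endpoints.\<close>
  have q_cont: "continuous_on UNIV (q x)" for x
  proof -
    have "continuous_on UNIV (\<lambda>t. q x (c t))"
      using less by (intro continuous_on_compose2[OF abs_cont_on_continuous_on[OF q_ac]])
        (auto simp: c_def intro!: continuous_intros)
    moreover have "q x (c t) = q x t" for t by (simp add: q_def c_id[OF c_in])
    ultimately show ?thesis by simp
  qed
  obtain D where D: "(\<lambda>(x, t). D x t) \<in> borel_measurable (\<nu> \<Otimes>\<^sub>M borel)"
    "{z \<in> space (\<nu> \<Otimes>\<^sub>M borel). (q (fst z) has_real_derivative D (fst z) (snd z)) (at (snd z))} \<in> sets (\<nu> \<Otimes>\<^sub>M borel)"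
    "\<And>x t d. (q x has_real_derivative d) (at t) \<Longrightarrow> D x t = d"
    using measurable_partial_derivative[of q \<nu>] q_meas q_cont by (auto simp: case_prod_beta')
  have sets_eq: "sets (\<nu> \<Otimes>\<^sub>M lborel) = sets (\<nu> \<Otimes>\<^sub>M (borel :: real measure))"
    by (intro sets_pair_measure_cong) auto
  have q_section[measurable]: "(\<lambda>x. q x t) \<in> borel_measurable \<nu>" for t
    using measurable_Pair1[OF q_meas, of t] by simp
  have D_section[measurable]: "(\<lambda>x. D x t) \<in> borel_measurable \<nu>" for t
    using measurable_Pair1[OF D(1), of t] by simp
  have deriv_xt: "AE x in \<nu>. AE t in lborel. t \<in> {t1<..<t2} \<longrightarrow> (q x has_real_derivative D x t) (at t)"
  proof (rule AE_I2)
    fix x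
    obtain h where "AE t in lborel. t \<in> {t1<..<t2} \<longrightarrow> (q x has_real_derivative h t) (at t)"
      using abs_cont_on_fundamental[OF q_ac less] by blast
    then show "AE t in lborel. t \<in> {t1<..<t2} \<longrightarrow> (q x has_real_derivative D x t) (at t)"
      by eventually_elim (metis D(3))
  qed
  \<comment> \<open>\<open>deriv_xt\<close> allows integration in \<open>t\<close> for fixed
    \<open>x\<close>; the estimates for fixed \<open>t\<close> need the quantifiers in the other
    order. The exchange is valid because the set in question is measurable.\<close>
  have deriv_tx: "AE t in lborel. AE x in \<nu>. t \<in> {t1<..<t2} \<longrightarrow> (q x has_real_derivative D x t) (at t)"
  proof (subst AE_commute[symmetric])
    have "{z \<in> space (\<nu> \<Otimes>\<^sub>M lborel). snd z \<in> {t1<..<t2} \<longrightarrow> (q (fst z) has_real_derivative D (fst z) (snd z)) (at (snd z))} =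
      {z \<in> space (\<nu> \<Otimes>\<^sub>M borel). (q (fst z) has_real_derivative D (fst z) (snd z)) (at (snd z))} \<union>
      (space \<nu> \<times> (- {t1<..<t2}))"
      by (auto simp: space_pair_measure)
    also have "\<dots> \<in> sets (\<nu> \<Otimes>\<^sub>M lborel)"
      unfolding sets_eq by (intro sets.Un D(2) pair_measureI) auto
    finally show "{z \<in> space (\<nu> \<Otimes>\<^sub>M lborel). snd z \<in> {t1<..<t2} \<longrightarrow> (q (fst z) has_real_derivative D (fst z) (snd z)) (at (snd z))}
      \<in> sets (\<nu> \<Otimes>\<^sub>M lborel)" .
  qed (rule deriv_xt)
  have "smooth_model \<nu> q D t1 t2 (fisher_info \<nu> p t1 t2)"
  proof unfold_locales
    show "has_bochner_integral \<nu> (\<lambda>x. q x t) 1" if t: "t \<in> {t1..t2}" for t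
    proof (rule has_bochner_integral_nn_integral)
      have "(\<integral>\<^sup>+ x. ennreal (q x t) \<partial>\<nu>) = (\<integral>\<^sup>+ x. ennreal (p x t) \<partial>\<nu>)"
        using q_AE[OF t] by (intro nn_integral_cong_AE) auto
      then show "(\<integral>\<^sup>+ x. ennreal (q x t) \<partial>\<nu>) = ennreal 1" using p_dens[OF t] by simp
    qed (auto intro: AE_I2 q_nonneg)
    show "AE t in lborel. t \<in> {t1<..<t2} \<longrightarrow>
        has_bochner_integral \<nu> (\<lambda>x. (D x t)\<^sup>2 / q x t) (fisher_info \<nu> p t1 t2 t)"
      using deriv_tx
    proof eventually_elim
      case (elim t)
      show ?case
      proof
        assume t: "t \<in> {t1<..<t2}"
        then have t': "t \<in> {t1..t2}" by auto
        have int: "integrable \<nu> (\<lambda>x. (pdt p t1 t2 x t)\<^sup>2 / p x t)" by (rule I_fin[OF t'])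
        \<comment> \<open>For fixed interior \<open>t\<close> the two integrands agree almost
          everywhere. Measurability of the one with \<open>pdt\<close> is part of the assumed
          integrability.\<close>
        have "AE x in \<nu>. (pdt p t1 t2 x t)\<^sup>2 / p x t = (D x t)\<^sup>2 / q x t"
          using elim notN
        proof eventually_elim
          case (elim x)
          then have "pdt p t1 t2 x t = D x t" using t qp by (intro pdt_eq_derivative[of _ _ _ "q x"]) auto
          then show ?case using qp[OF elim(2) t'] by simp
        qed
        moreover have "has_bochner_integral \<nu> (\<lambda>x. (pdt p t1 t2 x t)\<^sup>2 / p x t) (fisher_info \<nu> p t1 t2 t)"
          using int by (simp add: has_bochner_integral_iff fisher_info_def)
        ultimately show "has_bochner_integral \<nu> (\<lambda>x. (D x t)\<^sup>2 / q x t) (fisher_info \<nu> p t1 t2 t)"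
          using int by (subst (asm) has_bochner_integral_cong_AE) auto
      qed
    qed
    show "(\<lambda>z. q (fst z) (snd z)) \<in> borel_measurable (\<nu> \<Otimes>\<^sub>M lborel)"
      "(\<lambda>z. D (fst z) (snd z)) \<in> borel_measurable (\<nu> \<Otimes>\<^sub>M lborel)"
      using q_meas D(1) measurable_cong_sets[OF sets_eq refl] by (auto simp: case_prod_beta')
  qed (use less q_nonneg q_ac deriv_xt deriv_tx abs_cont_on_continuous_on[OF I_ac] in auto)
  then show thesis using q_AE that by blast
qed

text \<open>Here \<alpha> and \<alpha>' are exchanged for Borel representatives: \<alpha> is
  continued by its endpoint values, and \<alpha>' is replaced by a density \<open>\<beta>\<close> of
  the continued function. Both are almost everywhere its derivative, so they agree almost everywhere
  and the integral of \<open>K\<close> is not affected.\<close>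

lemma (in smooth_model) admissible_bound:
  fixes th :: "'a \<Rightarrow> real"
  assumes th: "th \<in> borel_measurable \<nu>"
    and risk: "\<And>t. t \<in> {t1<..<t2} \<Longrightarrow> (\<integral>\<^sup>+x. ennreal ((th x - t)\<^sup>2 * q x t) \<partial>\<nu>) \<le> ennreal S" "0 \<le> S"
    and adm: "admissible t1 t2 \<alpha> \<alpha>'"
  shows "(integral {t1..t2} \<alpha> / integral {t1..t2} (\<lambda>t. sqrt (I t * (\<alpha> t)\<^sup>2 + (\<alpha>' t)\<^sup>2)))\<^sup>2 \<le> S"
proof -
  let ?\<chi> = "indicator {t1<..<t2} :: real \<Rightarrow> real"
  define K where "K t = sqrt (I t * (\<alpha> t)\<^sup>2 + (\<alpha>' t)\<^sup>2)" for t
  define \<alpha>c where "\<alpha>c t = \<alpha> (max t1 (min t2 t))" for t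
  have \<alpha>c: "\<alpha>c t = \<alpha> t" if "t \<in> {t1..t2}" for t using that by (auto simp: \<alpha>c_def)
  have \<alpha>: "abs_cont_on t1 t2 \<alpha>" "\<alpha>' integrable_on {t1..t2}" "\<And>t. t \<in> {t1..t2} \<Longrightarrow> \<alpha> t = \<alpha> t1 + integral {t1..t} \<alpha>'"
    "abs_cont_on t1 t2 (\<lambda>t. (\<alpha>' t)\<^sup>2)" "\<alpha> t1 = 0" "\<alpha> t2 = 0"
    using adm by (auto simp: admissible_def)
  have ac: "abs_cont_on t1 t2 \<alpha>c" using \<alpha>(1) by (rule abs_cont_on_cong) (simp add: \<alpha>c)
  have "continuous_on UNIV \<alpha>c"
    unfolding \<alpha>c_def using less
    by (intro continuous_on_compose2[OF abs_cont_on_continuous_on[OF \<alpha>(1)]] continuous_intros) auto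
  then have \<alpha>c_meas: "\<alpha>c \<in> borel_measurable borel" by (rule borel_measurable_continuous_onI)
  obtain \<beta> where \<beta>: "integrable lborel \<beta>"
    "AE t in lborel. t \<in> {t1<..<t2} \<longrightarrow> (\<alpha>c has_real_derivative \<beta> t) (at t)"
    using abs_cont_on_fundamental[OF ac less] by blast
  have "AE t in lborel. t \<in> {t1<..<t2} \<longrightarrow> (\<alpha>c has_real_derivative \<alpha>' t) (at t)"
    using \<alpha>(2)
  proof (rule AE_derivative_of_indefinite_integral)
    fix t assume t: "t \<in> {t1..t2}"
    show "\<alpha>c t = \<alpha>c t1 + integral {t1..t} \<alpha>'" using \<alpha>(3)[OF t] \<alpha>c[OF t] \<alpha>c[of t1] less by simp
  qed
  with \<beta>(2) have "AE t in lborel. t \<in> {t1<..<t2} \<longrightarrow> K t = sqrt (I t * (\<alpha>c t)\<^sup>2 + (\<beta> t)\<^sup>2)"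
  proof eventually_elim
    case (elim t)
    then show ?case using DERIV_unique[of \<alpha>c "\<beta> t" t "\<alpha>' t"] \<alpha>c[of t] by (auto simp: K_def)
  qed
  \<comment> \<open>The weak derivative may change sign by a jump, but its square is absolutely
    continuous and hence \<open>K\<close> is continuous.\<close>
  moreover have K_int: "integrable lborel (\<lambda>t. ?\<chi> t * K t)"
    unfolding K_def using I_cont abs_cont_on_continuous_on[OF \<alpha>(1)]
    by (intro integrable_continuous_open_interval continuous_on_real_sqrt continuous_on_mult continuous_on_power
        continuous_on_add[OF _ abs_cont_on_continuous_on[OF \<alpha>(4)]])
  ultimately have le: "\<bar>\<integral>t. ?\<chi> t * \<alpha>c t \<partial>lborel\<bar> \<le> sqrt S * (\<integral>t. ?\<chi> t * K t \<partial>lborel)"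
    using \<beta> less \<alpha>(5,6) \<alpha>c[of t1] \<alpha>c[of t2]
    by (intro weighted_bound[OF th risk ac _ _ \<alpha>c_meas]) auto
  have "(\<lambda>t. ?\<chi> t * \<alpha>c t) = (\<lambda>t. ?\<chi> t * \<alpha> t)" using \<alpha>c by (auto simp: indicator_def)
  moreover have "integrable lborel (\<lambda>t. ?\<chi> t * \<alpha> t)"
    using abs_cont_on_continuous_on[OF \<alpha>(1)] by (rule integrable_continuous_open_interval)
  ultimately have le': "\<bar>integral {t1..t2} \<alpha>\<bar> \<le> sqrt S * integral {t1..t2} K"
    using le integral_open_interval_eq[OF K_int] by (simp add: integral_open_interval_eq)
  have "(integral {t1..t2} \<alpha> / integral {t1..t2} K)\<^sup>2 \<le> S"
  \<comment> \<open>With denominator 0 the quotient is 0 by convention, and the claim reduces to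
    nonnegativity of \<open>S\<close>.\<close>
  proof (cases "integral {t1..t2} K = 0")
    case False
    have "0 \<le> sqrt S * integral {t1..t2} K" using le' by linarith
    then have "\<bar>integral {t1..t2} \<alpha>\<bar>\<^sup>2 \<le> (sqrt S * integral {t1..t2} K)\<^sup>2"
      using le' by (intro power_mono) auto
    then have "(integral {t1..t2} \<alpha>)\<^sup>2 \<le> S * (integral {t1..t2} K)\<^sup>2"
      using risk(2) by (simp add: power_mult_distrib)
    then show ?thesis using False by (simp add: power_divide divide_le_eq)
  qed (use risk(2) in simp)
  then show ?thesis by (simp add: K_def[abs_def])
qed

theorem theorem2:
  fixes \<nu> :: "'a measure" and p :: "'a \<Rightarrow> real \<Rightarrow> real" and t1 t2 :: real
    and A :: "((real \<Rightarrow> real) \<times> (real \<Rightarrow> real)) set" and th :: "'a \<Rightarrow> real"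
  assumes sf: "sigma_finite_measure \<nu>"
    and p_meas: "(\<lambda>(x, t). p x t) \<in> borel_measurable (\<nu> \<Otimes>\<^sub>M restrict_space borel {t1..t2})"
    and p_nonneg: "\<forall>t\<in>{t1..t2}. \<forall>x\<in>space \<nu>. 0 \<le> p x t"
    and p_dens: "\<forall>t\<in>{t1..t2}. (\<integral>\<^sup>+ x. ennreal (p x t) \<partial>\<nu>) = 1"
    and p_ac: "AE x in \<nu>. abs_cont_on t1 t2 (\<lambda>t. p x t)"
    and I_fin: "\<forall>t\<in>{t1..t2}. integrable \<nu> (\<lambda>x. (pdt p t1 t2 x t)\<^sup>2 / p x t)"
    and I_int: "fisher_info \<nu> p t1 t2 integrable_on {t1..t2}"
    and I_ac: "abs_cont_on t1 t2 (fisher_info \<nu> p t1 t2)"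
    and A_adm: "\<forall>(\<alpha>, \<alpha>')\<in>A. admissible t1 t2 \<alpha> \<alpha>'"
    and th_meas: "th \<in> borel_measurable \<nu>"
  shows "(SUP t\<in>{t1..t2}. \<integral>\<^sup>+ x. ennreal ((th x - t)\<^sup>2) \<partial>(density \<nu> (\<lambda>x. ennreal (p x t))))
         \<ge> (SUP (\<alpha>, \<alpha>')\<in>A. ennreal ((integral {t1..t2} \<alpha> /
               integral {t1..t2} (\<lambda>t. sqrt (fisher_info \<nu> p t1 t2 t * (\<alpha> t)\<^sup>2 + (\<alpha>' t)\<^sup>2)))\<^sup>2))"
    (is "?risk \<ge> (SUP (\<alpha>, \<alpha>')\<in>A. ennreal (?bound \<alpha> \<alpha>'))")
proof (rule SUP_least)
  fix z assume "z \<in> A"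
  then obtain \<alpha> \<alpha>' where z: "z = (\<alpha>, \<alpha>')" and adm: "admissible t1 t2 \<alpha> \<alpha>'"
    using A_adm by auto
  have "ennreal (?bound \<alpha> \<alpha>') \<le> ?risk"
  proof (cases "t1 < t2")
    \<comment> \<open>The interval is empty or a single point, so the numerator vanishes and the
      bound is 0.\<close>
    case False
    then have "integral {t1..t2} \<alpha> = 0" by (cases "t1 = t2") auto
    then show ?thesis by simp
  next
    case less: True
    show ?thesis
    \<comment> \<open>A finite supremum supplies the uniform real bound \<open>S\<close> on the
      risk; an infinite one leaves nothing to prove.\<close>
    proof (cases ?risk)
      case (real S)
      obtain q D where "smooth_model \<nu> q D t1 t2 (fisher_info \<nu> p t1 t2)"
        and q_AE: "\<forall>t\<in>{t1..t2}. AE x in \<nu>. q x t = p x t"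
        by (rule smooth_model_of_density[OF sf less p_meas p_nonneg[rule_format] p_dens[rule_format] p_ac
              I_fin[rule_format] I_ac]) blast
      then interpret smooth_model \<nu> q D t1 t2 "fisher_info \<nu> p t1 t2" by simp
      have "(\<integral>\<^sup>+x. ennreal ((th x - t)\<^sup>2 * q x t) \<partial>\<nu>) \<le> ennreal S" if "t \<in> {t1<..<t2}" for t
      proof -
        have t: "t \<in> {t1..t2}" using that by auto
        have [measurable]: "(\<lambda>x. p x t) \<in> borel_measurable \<nu>"
          using measurable_Pair1[OF p_meas, of t] t by (simp add: space_restrict_space)
        have "(\<integral>\<^sup>+x. ennreal ((th x - t)\<^sup>2 * q x t) \<partial>\<nu>) = (\<integral>\<^sup>+x. ennreal (p x t) * ennreal ((th x - t)\<^sup>2) \<partial>\<nu>)"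
        proof (rule nn_integral_cong_AE)
          show "AE x in \<nu>. ennreal ((th x - t)\<^sup>2 * q x t) = ennreal (p x t) * ennreal ((th x - t)\<^sup>2)"
            using bspec[OF q_AE t] by eventually_elim (simp add: ennreal_mult'' mult.commute)
        qed
        also have "\<dots> = (\<integral>\<^sup>+ x. ennreal ((th x - t)\<^sup>2) \<partial>(density \<nu> (\<lambda>x. ennreal (p x t))))"
          using th_meas by (subst nn_integral_density) auto
        also have "\<dots> \<le> ?risk" using t by (rule SUP_upper)
        finally show ?thesis using real by simp
      qed
      then have "?bound \<alpha> \<alpha>' \<le> S" using real by (intro admissible_bound[OF th_meas _ _ adm]) auto
      then show ?thesis using real by (simp add: ennreal_leI)
    next
      case top
      show ?thesis unfolding top by (rule top_greatest)
    qed
  qed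
  then show "(case z of (\<alpha>, \<alpha>') \<Rightarrow> ennreal (?bound \<alpha> \<alpha>')) \<le> ?risk" by (simp add: z)
qed

end
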